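(* Let $\alpha,A>0$ and $1\le p<\infty$, and assume that $T_g:\mathcal{F}^p_{\alpha,A}\to\mathcal{F}^p_{\alpha,A}$ is bounded, that is, $g$ is a polynomial with $\deg(g)\le A$. Then the spectrum $\sigma(T_g)$ of $T_g$ on $\mathcal{F}^p_{\alpha,A}$ satisfies the following. (I) If $A\notin\mathbb{N}$, then $\sigma(T_g)=\{0\}$. (II) If $A\in\mathbb{N}$, then $$\sigma(T_g)=\left\{\lambda\in\mathbb{C}:\ |\lambda|\le\frac{|b|}{\alpha}\right\},$$ where $b$ is the coefficient of $z^A$ in the expansion of $g$.
   Context: $\mathbb{N}$ denotes the set of positive integers, and $dA$ denotes Lebesgue area measure on $\mathbb{C}$ (not to be confused with the exponent $A$). For $1\le p<\infty$ and $\alpha,A>0$, the generalized Fock space $\mathcal{F}^p_{\alpha,A}$ consists of all entire functions $f$ with $$\|f\|_{p,\alpha,A}=\left(\int_{\mathbb{C}}\bigl|f(z)e^{-\alpha|z|^A}\bigr|^p\,dA(z)\right)^{1/p}<\infty;$$ it is a complex Banach space with this norm. For an entire function $g$, the Volterra-type integration operator $T_g$ is defined on entire functions $f$ by $$T_gf(z)=\int_0^z f(\zeta)g'(\zeta)\,d\zeta,\qquad z\in\mathbb{C}.$$ It is a known result that $T_g$ is bounded on $\mathcal{F}^p_{\alpha,A}$ if and only if $g$ is a polynomial of degree $\le A$. The coefficient $b$ in (II) may be $0$ (when $\deg g<A$). *)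

theory Defs
  imports "HOL-Complex_Analysis.Complex_Analysis"
begin

definition fock_space :: "real \<Rightarrow> real \<Rightarrow> real \<Rightarrow> (complex \<Rightarrow> complex) set" where
  "fock_space p \<alpha> A = {f. f holomorphic_on UNIV \<and>
     integrable lborel (\<lambda>z::complex. norm (f z * of_real (exp (- \<alpha> * norm z powr A))) powr p)}"

definition fock_norm :: "real \<Rightarrow> real \<Rightarrow> real \<Rightarrow> (complex \<Rightarrow> complex) \<Rightarrow> real" where
  "fock_norm p \<alpha> A f =
     (LINT z::complex|lborel. norm (f z * of_real (exp (- \<alpha> * norm z powr A))) powr p) powr (1 / p)"

definition volterra :: "(complex \<Rightarrow> complex) \<Rightarrow> (complex \<Rightarrow> complex) \<Rightarrow> complex \<Rightarrow> complex" where
  "volterra g f z = contour_integral (linepath 0 z) (\<lambda>\<zeta>. f \<zeta> * deriv g \<zeta>)"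

(* Since the space depends on real parameters, it is a carrier set V with a norm N rather than
   a type; operators are only constrained on V. *)

definition bounded_operator_on ::
  "(complex \<Rightarrow> complex) set \<Rightarrow> ((complex \<Rightarrow> complex) \<Rightarrow> real) \<Rightarrow>
   ((complex \<Rightarrow> complex) \<Rightarrow> (complex \<Rightarrow> complex)) \<Rightarrow> bool" where
  "bounded_operator_on V N T \<longleftrightarrow>
     (\<forall>f\<in>V. T f \<in> V) \<and>
     (\<forall>f\<in>V. \<forall>h\<in>V. \<forall>a b. T (\<lambda>z. a * f z + b * h z) = (\<lambda>z. a * T f z + b * T h z)) \<and>
     (\<exists>C. \<forall>f\<in>V. N (T f) \<le> C * N f)"

(* S below is a two-sided inverse of \<mu> I - T in the algebra of bounded operators on V. *)

definition operator_spectrum ::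
  "(complex \<Rightarrow> complex) set \<Rightarrow> ((complex \<Rightarrow> complex) \<Rightarrow> real) \<Rightarrow>
   ((complex \<Rightarrow> complex) \<Rightarrow> (complex \<Rightarrow> complex)) \<Rightarrow> complex set" where
  "operator_spectrum V N T = {\<mu>. \<not> (\<exists>S. bounded_operator_on V N S \<and>
     (\<forall>f\<in>V. S (\<lambda>z. \<mu> * f z - T f z) = f) \<and>
     (\<forall>f\<in>V. (\<lambda>z. \<mu> * S f z - T (S f) z) = f))}"

end

theory Submission
  imports Defs "HOL-Real_Asymp.Real_Asymp"
begin

text \<open>
  Let \<open>G = g - g(0)\<close>. Since \<open>T\<^sup>k 1 = G\<^sup>k / k!\<close>, boundedness of \<open>T\<close> and a pointwise estimate, applied with
  \<open>k\<close> of size \<open>|z|\<^sup>A\<close>, give \<open>G(z) = O(|z|\<^sup>A)\<close>, so \<open>g\<close> is a polynomial of degree at most \<open>A\<close>.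
  Put \<open>W = exp(G/\<mu>)\<close>. Solving the differential equation behind \<open>\<mu> f - T f = h\<close> yields the only possible
  resolvent, \<open>h/\<mu> + W/\<mu>\<^sup>2 \<integral>\<^sub>0\<^sup>z h g'/W\<close>.

  If \<open>|\<mu>| > |b|/\<alpha>\<close>, then \<open>|W| exp(-\<alpha>|z|\<^sup>A)\<close> decays along rays like \<open>exp(-d|z|\<^sup>A)\<close>, so the integral term is
  dominated by an operator along rays with kernel \<open>exp(-d|z|\<^sup>A(1 - t\<^sup>A)) |z|\<^sup>A t\<^bsup>A-1\<^esup>\<close>, acting on
  \<open>u = |h| exp(-\<alpha>|z|\<^sup>A)\<close> through \<open>u(tz)\<close>, \<open>0 < t \<le> 1\<close>. This is
  bounded in the p-th mean by Jensen's inequality, Tonelli's theorem and the substitution \<open>w = tz\<close>.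

  If \<open>0 < |\<mu>| \<le> |b|/\<alpha>\<close> and the resolvent existed, then all functions \<open>W G\<^sup>k\<close> would belong to the space, because
  \<open>(\<mu> - T) W = \<mu>\<close> and \<open>(\<mu> - T)(W G\<^bsup>k+1\<^esup>) = \<mu>(k+1) T(W G\<^sup>k)\<close>. As \<open>Re (G/\<mu>) \<ge> \<alpha>|z|\<^sup>A\<close> at some point of every
  circle about the origin, this contradicts the pointwise estimate for \<open>k = 3\<close>.
\<close>

section \<open>Lebesgue measure on the complex plane and Jensen's inequality\<close>

text \<open>A measure with the right values on boxes is Lebesgue measure, and a box pulls back to a
  product of intervals. This opens the way to iterated integrals over the plane.\<close>

lemma lborel_complex_eq_distr:
  "(lborel :: complex measure) = distr (lborel \<Otimes>\<^sub>M lborel) borel (\<lambda>(x, y). Complex x y)"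
proof (rule lborel_eqI)
  have [measurable]: "(\<lambda>(x, y). Complex x y) \<in> borel_measurable (lborel \<Otimes>\<^sub>M lborel)"
    unfolding Complex_eq by measurable
  fix l u :: complex
  assume le: "\<And>b. b \<in> Basis \<Longrightarrow> l \<bullet> b \<le> u \<bullet> b"
  have "(\<lambda>(x, y). Complex x y) -` box l u = {Re l<..<Re u} \<times> {Im l<..<Im u}"
    by (auto simp: in_box_complex_iff)
  moreover have "Re l \<le> Re u" "Im l \<le> Im u"
    using le[of 1] le[of \<i>] by (auto simp: Basis_complex_def)
  ultimately show "emeasure (distr (lborel \<Otimes>\<^sub>M lborel) borel (\<lambda>(x, y). Complex x y)) (box l u) = (\<Prod>b\<in>Basis. (u - l) \<bullet> b)"
    by (subst emeasure_distr)
       (auto simp: space_pair_measure lborel.emeasure_pair_measure_Times Basis_complex_def ennreal_mult complex_i_not_one)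
qed simp

text \<open>Both orders of integration matter: the first serves to select the vertical sides of a
  rectangle, the second the horizontal ones.\<close>

lemma nn_integral_lborel_complex:
  fixes f :: "complex \<Rightarrow> ennreal"
  assumes [measurable]: "f \<in> borel_measurable borel"
  shows "(\<integral>\<^sup>+z. f z \<partial>lborel) = (\<integral>\<^sup>+x. \<integral>\<^sup>+y. f (Complex x y) \<partial>lborel \<partial>lborel)"
    and "(\<integral>\<^sup>+z. f z \<partial>lborel) = (\<integral>\<^sup>+y. \<integral>\<^sup>+x. f (Complex x y) \<partial>lborel \<partial>lborel)"
proof -
  have [measurable]: "(\<lambda>(x, y). Complex x y) \<in> borel_measurable (lborel \<Otimes>\<^sub>M lborel)"
    unfolding Complex_eq by measurable
  have *: "(\<integral>\<^sup>+z. f z \<partial>lborel) = (\<integral>\<^sup>+w. f (Complex (fst w) (snd w)) \<partial>(lborel \<Otimes>\<^sub>M lborel))"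
    by (subst lborel_complex_eq_distr) (simp add: nn_integral_distr case_prod_beta')
  have [measurable]: "(\<lambda>w. f (Complex (fst w) (snd w))) \<in> borel_measurable (lborel \<Otimes>\<^sub>M lborel)"
    unfolding Complex_eq by measurable
  show "(\<integral>\<^sup>+z. f z \<partial>lborel) = (\<integral>\<^sup>+x. \<integral>\<^sup>+y. f (Complex x y) \<partial>lborel \<partial>lborel)"
    unfolding * by (subst lborel.nn_integral_fst[symmetric]) auto
  show "(\<integral>\<^sup>+z. f z \<partial>lborel) = (\<integral>\<^sup>+y. \<integral>\<^sup>+x. f (Complex x y) \<partial>lborel \<partial>lborel)"
    unfolding * by (subst lborel_pair.nn_integral_snd[symmetric]) (auto simp: case_prod_beta')
qed

text \<open>The convex function \<open>v powr p\<close> lies above its tangent at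
  \<open>m\<close>.\<close>

lemma Young_tangent:
  fixes p m v :: real
  assumes "1 \<le> p" "0 < m" "0 \<le> v"
  shows "p * m powr (p - 1) * v \<le> v powr p + (p - 1) * m powr p"
proof (cases "v = 0")
  case False
  \<comment> \<open>By homogeneity the point of tangency may be moved to 1.\<close>
  have "1 + p * (v / m - 1) \<le> (v / m) powr p"
  proof -
    have "p * (v / m - 1) \<le> (v / m) powr p - 1 powr p"
      using False assms
      by (intro convex_on_imp_above_tangent[OF powr_convex[OF \<open>1 \<le> p\<close>]])
         (auto simp: interior_open intro!: derivative_eq_intros)
    then show ?thesis by simp
  qed
  then have "(1 + p * (v / m - 1)) * m powr p \<le> (v / m) powr p * m powr p"
    by (rule mult_right_mono) simp
  then show ?thesis using assms False
    by (simp add: powr_divide powr_diff field_simps)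
qed (use assms in simp)

text \<open>Jensen's inequality for a kernel of total mass at most \<open>M\<close>. Integrating the
  tangent inequality against \<open>k\<close> keeps everything linear, so the kernel need not be
  normalised. As \<open>x\<close> is just a real number below the integral of \<open>k * v\<close>,
  that integral may be infinite.\<close>

lemma powr_nn_integral_le:
  fixes k :: "'a \<Rightarrow> ennreal" and v :: "'a \<Rightarrow> real"
  assumes [measurable]: "k \<in> borel_measurable N" "v \<in> borel_measurable N"
    and v: "\<And>t. 0 \<le> v t" and M: "(\<integral>\<^sup>+t. k t \<partial>N) \<le> ennreal M" "0 < M" and "1 \<le> p" "0 \<le> x"
    and x: "ennreal x \<le> (\<integral>\<^sup>+t. k t * ennreal (v t) \<partial>N)"
  shows "ennreal (x powr p) \<le> ennreal (M powr (p - 1)) * (\<integral>\<^sup>+t. k t * ennreal (v t powr p) \<partial>N)"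
proof (cases "x = 0")
  case False
  \<comment> \<open>This point of tangency makes \<open>m powr (p - 1) * x\<close> equal to
    \<open>m powr p * M\<close>, so the integrated inequality collapses to
    \<open>m powr p * M \<le> y\<close>.\<close>
  define m where "m = x / M"
  have "m > 0" using False assms by (simp add: m_def)
  define Y where "Y = (\<integral>\<^sup>+t. k t * ennreal (v t powr p) \<partial>N)"
  show ?thesis
  proof (cases Y)
    case (real y)
    have "ennreal (p * m powr (p - 1) * x) \<le> ennreal (p * m powr (p - 1)) * (\<integral>\<^sup>+t. k t * ennreal (v t) \<partial>N)"
      using x \<open>1 \<le> p\<close> \<open>0 \<le> x\<close> by (subst ennreal_mult) (auto intro!: mult_left_mono)
    also have "\<dots> = (\<integral>\<^sup>+t. ennreal (p * m powr (p - 1)) * (k t * ennreal (v t)) \<partial>N)"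
      by (subst nn_integral_cmult) auto
    also have "\<dots> \<le> (\<integral>\<^sup>+t. k t * ennreal (v t powr p) + ennreal ((p - 1) * m powr p) * k t \<partial>N)"
    proof (rule nn_integral_mono)
      fix t
      have "ennreal (p * m powr (p - 1)) * (k t * ennreal (v t)) = k t * ennreal (p * m powr (p - 1) * v t)"
        using \<open>1 \<le> p\<close> v[of t] by (subst ennreal_mult) (auto simp: mult_ac)
      also have "\<dots> \<le> k t * ennreal (v t powr p + (p - 1) * m powr p)"
        using Young_tangent[OF \<open>1 \<le> p\<close> \<open>m > 0\<close> v[of t]] by (intro mult_left_mono ennreal_leI) auto
      also have "\<dots> = k t * ennreal (v t powr p) + ennreal ((p - 1) * m powr p) * k t"
        using \<open>1 \<le> p\<close> by (subst ennreal_plus) (auto simp: distrib_left mult_ac)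
      finally show "ennreal (p * m powr (p - 1)) * (k t * ennreal (v t)) \<le> \<dots>" .
    qed
    also have "\<dots> = Y + ennreal ((p - 1) * m powr p) * (\<integral>\<^sup>+t. k t \<partial>N)"
      by (simp add: nn_integral_add nn_integral_cmult Y_def)
    also have "\<dots> \<le> ennreal y + ennreal ((p - 1) * m powr p) * ennreal M"
      using M real by (intro add_mono mult_left_mono) auto
    also have "\<dots> = ennreal (y + (p - 1) * m powr p * M)"
      using \<open>1 \<le> p\<close> real M by (simp add: ennreal_mult ennreal_plus)
    finally have "p * m powr (p - 1) * x \<le> y + (p - 1) * m powr p * M"
      using real M \<open>1 \<le> p\<close> by (subst (asm) ennreal_le_iff) auto
    moreover have "m powr (p - 1) * x = m powr p * M"
      using \<open>m > 0\<close> M by (simp add: m_def powr_diff field_simps)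
    ultimately have "m powr p * M \<le> y"
      by (simp add: algebra_simps)
    moreover have "m powr p * M * M powr (p - 1) = x powr p"
      using \<open>m > 0\<close> M \<open>0 \<le> x\<close> by (simp add: m_def powr_diff powr_divide field_simps)
    ultimately have "x powr p \<le> M powr (p - 1) * y"
      by (metis mult.commute mult_right_mono powr_ge_zero)
    then have "ennreal (x powr p) \<le> ennreal (M powr (p - 1)) * ennreal y"
      using real by (subst ennreal_mult[symmetric]) (auto intro: ennreal_leI)
    then show ?thesis using real by (simp add: Y_def)
  next
    case top
    then show ?thesis using M by (simp add: Y_def ennreal_mult_eq_top_iff ennreal_mult_top)
  qed
qed simp

section \<open>A mean value inequality for entire functions\<close>

text \<open>Larger values throughout would push the integral up to at least \<open>T'\<close>; the
  gap \<open>T < T'\<close> turns this into a contradiction.\<close>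

lemma exists_le_mean_nn_integral:
  fixes \<phi> :: "real \<Rightarrow> ennreal"
  assumes "a < b" "T < T'" and T: "(\<integral>\<^sup>+x. \<phi> x * indicator {a..b} x \<partial>lborel) \<le> ennreal T" and "0 \<le> T"
  shows "\<exists>x\<in>{a..b}. \<phi> x \<le> ennreal (T' / (b - a))"
proof (rule ccontr)
  assume "\<not> ?thesis"
  then have "(\<integral>\<^sup>+x. ennreal (T' / (b - a)) * indicator {a..b} x \<partial>lborel) \<le> (\<integral>\<^sup>+x. \<phi> x * indicator {a..b} x \<partial>lborel)"
    by (intro nn_integral_mono) (auto simp: indicator_def not_le less_imp_le)
  also have "(\<integral>\<^sup>+x. ennreal (T' / (b - a)) * indicator {a..b} x \<partial>lborel) = ennreal T'"
    using assms by (subst nn_integral_cmult_indicator) (auto simp: ennreal_mult[symmetric])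
  finally show False
    using T \<open>T < T'\<close> \<open>0 \<le> T\<close> by (meson ennreal_le_iff linorder_not_le order_trans)
qed

lemma norm_integral_le_nn_integral:
  fixes F :: "real \<Rightarrow> complex"
  assumes F: "continuous_on {a..b} F"
  shows "ennreal (norm (integral {a..b} F)) \<le> (\<integral>\<^sup>+y. ennreal (norm (F y)) * indicator {a..b} y \<partial>lborel)"
proof -
  have si: "set_integrable lborel {a..b} (\<lambda>y. norm (F y))"
    using F by (intro borel_integrable_atLeastAtMost' continuous_intros)
  have "norm (integral {a..b} F) \<le> integral {a..b} (\<lambda>y. norm (F y))"
    using F by (intro integral_norm_bound_integral integrable_continuous_interval continuous_intros) auto
  also have "\<dots> = (LINT y:{a..b}|lborel. norm (F y))"
    by (rule set_borel_integral_eq_integral(2)[OF si, symmetric])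
  finally have "ennreal (norm (integral {a..b} F)) \<le> ennreal (LINT y:{a..b}|lborel. norm (F y))"
    by (rule ennreal_leI)
  also have "\<dots> = (\<integral>\<^sup>+y. ennreal (indicator {a..b} y *\<^sub>R norm (F y)) \<partial>lborel)"
    unfolding set_lebesgue_integral_def
    by (rule nn_integral_eq_integral[symmetric]) (use si in \<open>auto simp: set_integrable_def\<close>)
  also have "\<dots> = (\<integral>\<^sup>+y. ennreal (norm (F y)) * indicator {a..b} y \<partial>lborel)"
    by (intro nn_integral_cong) (auto simp: indicator_def)
  finally show ?thesis .
qed

text \<open>Estimates the share of one side of a rectangle in Cauchy's formula, \<open>k\<close>
  being the difference to the centre. The set \<open>I\<close> is the full side of the surrounding
  square, on which the bound \<open>B\<close> is known before the corners are chosen.\<close>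

lemma norm_integral_Cauchy_kernel_le:
  fixes F k :: "real \<Rightarrow> complex"
  assumes F: "continuous_on {a..b} F" "continuous_on {a..b} k"
    and k: "\<And>y. y \<in> {a..b} \<Longrightarrow> \<delta> \<le> norm (k y)" and "0 < \<delta>"
    and I: "{a..b} \<subseteq> I" "(\<integral>\<^sup>+y. ennreal (norm (F y)) * indicator I y \<partial>lborel) \<le> ennreal B" "0 \<le> B"
    and [measurable]: "F \<in> borel_measurable borel" "I \<in> sets borel"
  shows "norm (integral {a..b} (\<lambda>y. F y / k y)) \<le> B / \<delta>"
proof -
  have "k y \<noteq> 0" if "y \<in> {a..b}" for y
    using k[OF that] \<open>0 < \<delta>\<close> by auto
  then have "continuous_on {a..b} (\<lambda>y. F y / k y)"
    using F by (intro continuous_intros) auto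
  then have "ennreal (norm (integral {a..b} (\<lambda>y. F y / k y))) \<le> (\<integral>\<^sup>+y. ennreal (norm (F y / k y)) * indicator {a..b} y \<partial>lborel)"
    by (rule norm_integral_le_nn_integral)
  also have "(\<integral>\<^sup>+y. ennreal (norm (F y / k y)) * indicator {a..b} y \<partial>lborel)
      \<le> (\<integral>\<^sup>+y. ennreal (1 / \<delta>) * (ennreal (norm (F y)) * indicator I y) \<partial>lborel)"
  proof (rule nn_integral_mono)
    fix y
    have "norm (F y / k y) \<le> 1 / \<delta> * norm (F y)" if "y \<in> {a..b}"
      using k[OF that] \<open>0 < \<delta>\<close> by (simp add: norm_divide divide_left_mono frac_le)
    then show "ennreal (norm (F y / k y)) * indicator {a..b} y \<le> ennreal (1 / \<delta>) * (ennreal (norm (F y)) * indicator I y)"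
      using I(1) \<open>0 < \<delta>\<close> by (auto simp: indicator_def ennreal_mult[symmetric] intro!: ennreal_leI)
  qed
  also have "\<dots> = ennreal (1 / \<delta>) * (\<integral>\<^sup>+y. ennreal (norm (F y)) * indicator I y \<partial>lborel)"
    by (intro nn_integral_cmult) auto
  also have "\<dots> \<le> ennreal (1 / \<delta>) * ennreal B"
    using I by (intro mult_left_mono) auto
  also have "\<dots> = ennreal (B / \<delta>)"
    using I \<open>0 < \<delta>\<close> by (simp add: ennreal_mult[symmetric])
  finally show ?thesis
    using I \<open>0 < \<delta>\<close> by simp
qed

lemma contour_integral_linepath_same_Im:
  assumes "a < b"
  shows "contour_integral (linepath (Complex a c) (Complex b c)) f = integral {a..b} (\<lambda>x. f (Complex x c))"
proof -
  have "linepath (Complex a c) (Complex b c) = (+) (\<i> * of_real c) \<circ> linepath (of_real a) (of_real b)"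
    by (auto simp: linepath_def fun_eq_iff Complex_eq scaleR_conv_of_real algebra_simps)
  then have "contour_integral (linepath (Complex a c) (Complex b c)) f
      = contour_integral (linepath (of_real a) (of_real b)) (\<lambda>x. f (x + \<i> * of_real c))"
    by (simp add: contour_integral_translate)
  also have "\<dots> = integral {a..b} (\<lambda>x. f (Complex x c))"
    using assms by (subst contour_integral_linepath_Reals_eq) (auto simp: Complex_eq)
  finally show ?thesis .
qed

text \<open>Cauchy's formula on a rectangle around \<open>z\<close>, with each side chosen by a mean value argument so that
  the line integral of \<open>|f|\<close> over it is at most \<open>T'/\<delta>\<close>, where \<open>T' > T\<close> is arbitrary.\<close>

lemma norm_le_nn_integral_square:
  fixes f :: "complex \<Rightarrow> complex"
  assumes hol: "f holomorphic_on UNIV" and "0 < \<delta>" "0 \<le> T"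
    and T: "(\<integral>\<^sup>+w. ennreal (norm (f w)) * indicator {w. \<bar>Re w - Re z\<bar> \<le> 2 * \<delta> \<and> \<bar>Im w - Im z\<bar> \<le> 2 * \<delta>} w \<partial>lborel) \<le> ennreal T"
  shows "norm (f z) \<le> T / \<delta>\<^sup>2"
proof -
  have cont: "continuous_on S f" for S
    using hol holomorphic_on_imp_continuous_on holomorphic_on_subset by blast
  then have [measurable]: "f \<in> borel_measurable borel"
    by (rule borel_measurable_continuous_onI)
  define x0 y0 where "x0 = Re z" and "y0 = Im z"
  define X Y where "X = {x0 - 2 * \<delta>..x0 + 2 * \<delta>}" and "Y = {y0 - 2 * \<delta>..y0 + 2 * \<delta>}"
  have [measurable]: "X \<in> sets borel" "Y \<in> sets borel"
    by (auto simp: X_def Y_def)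
  have [measurable]: "(\<lambda>y. f (Complex x y)) \<in> borel_measurable borel" "(\<lambda>x. f (Complex x y)) \<in> borel_measurable borel" for x y
    unfolding Complex_eq by measurable
  define I where "I x = (\<integral>\<^sup>+y. ennreal (norm (f (Complex x y))) * indicator Y y \<partial>lborel)" for x
  define J where "J y = (\<integral>\<^sup>+x. ennreal (norm (f (Complex x y))) * indicator X x \<partial>lborel)" for y
  define Q where "Q = {w. \<bar>Re w - Re z\<bar> \<le> 2 * \<delta> \<and> \<bar>Im w - Im z\<bar> \<le> 2 * \<delta>}"
  have Q: "indicator Q (Complex x y) = (indicator X x * indicator Y y :: ennreal)" for x y
    by (auto simp: Q_def X_def Y_def x0_def y0_def indicator_def abs_le_iff)
  have [measurable]: "Q \<in> sets borel"
    unfolding Q_def by measurable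
  have "(\<integral>\<^sup>+x. I x * indicator X x \<partial>lborel) = (\<integral>\<^sup>+w. ennreal (norm (f w)) * indicator Q w \<partial>lborel)"
    by (subst nn_integral_lborel_complex(1)) (auto simp: I_def Q nn_integral_cmult mult_ac intro!: nn_integral_cong)
  then have IT: "(\<integral>\<^sup>+x. I x * indicator X x \<partial>lborel) \<le> ennreal T"
    using T by (simp add: Q_def)
  have "(\<integral>\<^sup>+x. J x * indicator Y x \<partial>lborel) = (\<integral>\<^sup>+w. ennreal (norm (f w)) * indicator Q w \<partial>lborel)"
    by (subst nn_integral_lborel_complex(2)) (auto simp: J_def Q nn_integral_cmult[symmetric] mult_ac intro!: nn_integral_cong)
  then have JT: "(\<integral>\<^sup>+x. J x * indicator Y x \<partial>lborel) \<le> ennreal T"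
    using T by (simp add: Q_def)
  have sub: "(\<integral>\<^sup>+x. \<phi> x * indicator A x \<partial>lborel) \<le> ennreal T" 
    if "A \<subseteq> B" "(\<integral>\<^sup>+x. \<phi> x * indicator B x \<partial>lborel) \<le> ennreal T" for A B and \<phi> :: "real \<Rightarrow> ennreal"
    by (rule order_trans[OF nn_integral_mono that(2)]) (use that(1) in \<open>auto simp: indicator_def\<close>)
  have bound: "norm (f z) * \<delta>\<^sup>2 \<le> T'" if "T < T'" for T'
  proof -
    define B where "B = T' / \<delta>"
    have B: "0 \<le> B" using that \<open>0 \<le> T\<close> \<open>0 < \<delta>\<close> by (simp add: B_def)
    \<comment> \<open>Each side is sought in a strip at distance between \<open>\<delta>\<close> and
      \<open>2 * \<delta>\<close> from \<open>z\<close>: far enough away to bound the Cauchy kernel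
      by \<open>1 / \<delta>\<close>, yet inside the square. The strip has width
      \<open>\<delta>\<close>, whence the value \<open>B\<close>.\<close>
    have "\<exists>x\<in>{x0 - 2 * \<delta>..x0 - \<delta>}. I x \<le> ennreal (T' / (x0 - \<delta> - (x0 - 2 * \<delta>)))"
      using \<open>0 < \<delta>\<close> \<open>0 \<le> T\<close> that by (intro exists_le_mean_nn_integral[where T = T] sub[OF _ IT]) (auto simp: X_def)
    then obtain x1 where x1: "x1 \<in> {x0 - 2 * \<delta>..x0 - \<delta>}" "I x1 \<le> ennreal B" by (auto simp: B_def)
    have "\<exists>x\<in>{x0 + \<delta>..x0 + 2 * \<delta>}. I x \<le> ennreal (T' / (x0 + 2 * \<delta> - (x0 + \<delta>)))"
      using \<open>0 < \<delta>\<close> \<open>0 \<le> T\<close> that by (intro exists_le_mean_nn_integral[where T = T] sub[OF _ IT]) (auto simp: X_def)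
    then obtain x2 where x2: "x2 \<in> {x0 + \<delta>..x0 + 2 * \<delta>}" "I x2 \<le> ennreal B" by (auto simp: B_def)
    have "\<exists>x\<in>{y0 - 2 * \<delta>..y0 - \<delta>}. J x \<le> ennreal (T' / (y0 - \<delta> - (y0 - 2 * \<delta>)))"
      using \<open>0 < \<delta>\<close> \<open>0 \<le> T\<close> that by (intro exists_le_mean_nn_integral[where T = T] sub[OF _ JT]) (auto simp: Y_def)
    then obtain y1 where y1: "y1 \<in> {y0 - 2 * \<delta>..y0 - \<delta>}" "J y1 \<le> ennreal B" by (auto simp: B_def)
    have "\<exists>x\<in>{y0 + \<delta>..y0 + 2 * \<delta>}. J x \<le> ennreal (T' / (y0 + 2 * \<delta> - (y0 + \<delta>)))"
      using \<open>0 < \<delta>\<close> \<open>0 \<le> T\<close> that by (intro exists_le_mean_nn_integral[where T = T] sub[OF _ JT]) (auto simp: Y_def)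
    then obtain y2 where y2: "y2 \<in> {y0 + \<delta>..y0 + 2 * \<delta>}" "J y2 \<le> ennreal B" by (auto simp: B_def)
    have lt: "x1 < x0" "x0 < x2" "y1 < y0" "y0 < y2" "x1 < x2" "y1 < y2"
      using x1 x2 y1 y2 \<open>0 < \<delta>\<close> by auto
    define F where "F w = f w / (w - z)" for w
    define a1 a2 a3 a4 where "a1 = Complex x1 y1" and "a2 = Complex x2 y1" and "a3 = Complex x2 y2" and "a4 = Complex x1 y2"
    have rect: "rectpath a1 a3 = linepath a1 a2 +++ linepath a2 a3 +++ linepath a3 a4 +++ linepath a4 a1"
      by (simp add: rectpath_def Let_def a1_def a2_def a3_def a4_def)
    have zbox: "z \<in> box a1 a3"
      using lt by (simp add: in_box_complex_iff a1_def a3_def x0_def y0_def)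
    have disj: "z \<notin> path_image (rectpath a1 a3)"
      using zbox path_image_rectpath_inter_box[of a1 a3] lt by (auto simp: a1_def a3_def)
    have "(F has_contour_integral (2 * pi * \<i> * winding_number (rectpath a1 a3) z * f z)) (rectpath a1 a3)"
      unfolding F_def by (rule Cauchy_integral_formula_convex_simple[OF _ hol]) (use disj in auto)
    then have C: "(F has_contour_integral (2 * pi * \<i> * f z)) (rectpath a1 a3)"
      using zbox by (simp add: winding_number_rectpath)
    have seg: "F contour_integrable_on linepath a1 a2" "F contour_integrable_on linepath a2 a3"
      "F contour_integrable_on linepath a3 a4" "F contour_integrable_on linepath a4 a1"
      using disj by (auto simp: rect F_def path_image_join intro!: contour_integrable_continuous_linepath continuous_intros cont)
    have "2 * pi * \<i> * f z = contour_integral (rectpath a1 a3) F"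
      using C by (simp add: contour_integral_unique)
    also have "\<dots> = contour_integral (linepath a1 a2) F + (contour_integral (linepath a2 a3) F
        + (contour_integral (linepath a3 a4) F + contour_integral (linepath a4 a1) F))"
      unfolding rect using seg by (simp add: contour_integrable_joinI)
    also have "contour_integral (linepath a3 a4) F = - contour_integral (linepath a4 a3) F"
      using contour_integral_reversepath[of "linepath a4 a3" F] by simp
    also have "contour_integral (linepath a4 a1) F = - contour_integral (linepath a1 a4) F"
      using contour_integral_reversepath[of "linepath a1 a4" F] by simp
    finally have eq: "2 * pi * \<i> * f z = contour_integral (linepath a1 a2) F + (contour_integral (linepath a2 a3) F
        + (- contour_integral (linepath a4 a3) F + - contour_integral (linepath a1 a4) F))" .
    have vert: "norm (contour_integral (linepath (Complex x y1) (Complex x y2)) F) \<le> B / \<delta>"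
      if "I x \<le> ennreal B" "\<delta> \<le> \<bar>x - x0\<bar>" for x
    proof -
      have "norm (integral {y1..y2} (\<lambda>y. f (Complex x y) / (Complex x y - z))) \<le> B / \<delta>"
      proof (rule norm_integral_Cauchy_kernel_le[where I = Y])
        show "continuous_on {y1..y2} (\<lambda>y. f (Complex x y))" "continuous_on {y1..y2} (\<lambda>y. Complex x y - z)"
          unfolding Complex_eq by (auto intro!: continuous_intros continuous_on_compose2[OF cont[of UNIV]])
        fix y show "\<delta> \<le> norm (Complex x y - z)"
          using abs_Re_le_cmod[of "Complex x y - z"] that by (simp add: x0_def)
      qed (use that B y1 y2 \<open>0 < \<delta>\<close> in \<open>auto simp: I_def Y_def\<close>)
      then show ?thesis
        using lt by (subst contour_integral_linepath_same_Re) (auto simp: F_def norm_mult)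
    qed
    have horiz: "norm (contour_integral (linepath (Complex x1 y) (Complex x2 y)) F) \<le> B / \<delta>"
      if "J y \<le> ennreal B" "\<delta> \<le> \<bar>y - y0\<bar>" for y
    proof -
      have "norm (integral {x1..x2} (\<lambda>x. f (Complex x y) / (Complex x y - z))) \<le> B / \<delta>"
      proof (rule norm_integral_Cauchy_kernel_le[where I = X])
        show "continuous_on {x1..x2} (\<lambda>x. f (Complex x y))" "continuous_on {x1..x2} (\<lambda>x. Complex x y - z)"
          unfolding Complex_eq by (auto intro!: continuous_intros continuous_on_compose2[OF cont[of UNIV]])
        fix x show "\<delta> \<le> norm (Complex x y - z)"
          using abs_Im_le_cmod[of "Complex x y - z"] that by (simp add: y0_def)
      qed (use that B x1 x2 \<open>0 < \<delta>\<close> in \<open>auto simp: J_def X_def\<close>)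
      then show ?thesis
        using lt by (subst contour_integral_linepath_same_Im) (auto simp: F_def norm_mult)
    qed
    have "norm (2 * pi * \<i> * f z) \<le> B / \<delta> + (B / \<delta> + (B / \<delta> + B / \<delta>))"
      unfolding eq
      by (intro order_trans[OF norm_triangle_ineq] add_mono; unfold norm_minus_cancel a1_def a2_def a3_def a4_def)
         (intro vert horiz; use x1 x2 y1 y2 in auto)+
    then have "2 * pi * norm (f z) \<le> 4 * (B / \<delta>)"
      by (simp add: norm_mult)
    \<comment> \<open>The factor \<open>2 * pi\<close> is at least 4 and so absorbs the four
      sides.\<close>
    moreover have "2 * 2 * norm (f z) \<le> 2 * pi * norm (f z)"
      using pi_ge_two by (intro mult_right_mono mult_left_mono) auto
    ultimately have "norm (f z) \<le> B / \<delta>"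
      by linarith
    then show "norm (f z) * \<delta>\<^sup>2 \<le> T'"
      using \<open>0 < \<delta>\<close> by (simp add: B_def field_simps power2_eq_square)
  qed
  then have "norm (f z) * \<delta>\<^sup>2 \<le> T"
    by (rule dense_ge)
  then show ?thesis
    using \<open>0 < \<delta>\<close> by (simp add: field_simps)
qed

text \<open>Jensen's inequality for the kernel \<open>indicator Q / \<delta>\<^sup>2\<close>. Its
  mass is 16 because the square has side \<open>4 * \<delta>\<close>.\<close>

lemma norm_powr_le_nn_integral_square:
  fixes f :: "complex \<Rightarrow> complex"
  assumes hol: "f holomorphic_on UNIV" and "0 < \<delta>" "1 \<le> p"
  shows "ennreal (norm (f z) powr p) \<le> ennreal (16 powr (p - 1) / \<delta>\<^sup>2) *
    (\<integral>\<^sup>+w. ennreal (norm (f w) powr p) * indicator {w. \<bar>Re w - Re z\<bar> \<le> 2 * \<delta> \<and> \<bar>Im w - Im z\<bar> \<le> 2 * \<delta>} w \<partial>lborel)"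
proof -
  have "continuous_on UNIV f"
    using hol holomorphic_on_imp_continuous_on by blast
  then have [measurable]: "f \<in> borel_measurable borel"
    by (rule borel_measurable_continuous_onI)
  define Q where "Q = {w. \<bar>Re w - Re z\<bar> \<le> 2 * \<delta> \<and> \<bar>Im w - Im z\<bar> \<le> 2 * \<delta>}"
  have [measurable]: "Q \<in> sets borel"
    unfolding Q_def by measurable
  have Qc: "Q = cbox (Complex (Re z - 2 * \<delta>) (Im z - 2 * \<delta>)) (Complex (Re z + 2 * \<delta>) (Im z + 2 * \<delta>))"
    by (auto simp: Q_def in_cbox_complex_iff abs_le_iff)
  then have mQ: "emeasure lborel Q = ennreal (16 * \<delta>\<^sup>2)"
    using \<open>0 < \<delta>\<close> by (simp add: emeasure_lborel_cbox_eq Basis_complex_def power2_eq_square complex_i_not_one)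
  have "ennreal (norm (f z) powr p) \<le> ennreal (16 powr (p - 1)) *
     (\<integral>\<^sup>+w. ennreal (1 / \<delta>\<^sup>2) * indicator Q w * ennreal (norm (f w) powr p) \<partial>lborel)"
  proof (rule powr_nn_integral_le)
    show "(\<integral>\<^sup>+w. ennreal (1 / \<delta>\<^sup>2) * indicator Q w \<partial>lborel) \<le> ennreal 16"
      using \<open>0 < \<delta>\<close> by (subst nn_integral_cmult_indicator) (auto simp: mQ ennreal_mult[symmetric])
    \<comment> \<open>Compactness of the square makes the integral of the modulus finite, so that it
      can serve as the real bound \<open>T\<close>.\<close>
    have "continuous_on (cbox (Complex (Re z - 2 * \<delta>) (Im z - 2 * \<delta>)) (Complex (Re z + 2 * \<delta>) (Im z + 2 * \<delta>))) f"
      using \<open>continuous_on UNIV f\<close> continuous_on_subset by blast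
    then have "bounded (f ` Q)"
      unfolding Qc by (intro compact_imp_bounded compact_continuous_image) auto
    then obtain K where K: "\<And>w. w \<in> Q \<Longrightarrow> norm (f w) \<le> K"
      by (auto simp: bounded_iff)
    have "(\<integral>\<^sup>+w. ennreal (norm (f w)) * indicator Q w \<partial>lborel) \<le> (\<integral>\<^sup>+w. ennreal K * indicator Q w \<partial>lborel)"
      using K by (intro nn_integral_mono) (auto simp: indicator_def intro!: ennreal_leI)
    also have "\<dots> < \<infinity>"
      by (subst nn_integral_cmult_indicator) (auto simp: mQ ennreal_mult_less_top)
    finally obtain T where T: "(\<integral>\<^sup>+w. ennreal (norm (f w)) * indicator Q w \<partial>lborel) = ennreal T" "0 \<le> T"
      by (cases "(\<integral>\<^sup>+w. ennreal (norm (f w)) * indicator Q w \<partial>lborel)") auto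
    then have "norm (f z) \<le> T / \<delta>\<^sup>2"
      using hol \<open>0 < \<delta>\<close> by (intro norm_le_nn_integral_square) (auto simp: Q_def)
    then have "ennreal (norm (f z)) \<le> ennreal (1 / \<delta>\<^sup>2) * ennreal T"
      using T(2) by (simp add: ennreal_mult[symmetric] ennreal_leI)
    also have "\<dots> = (\<integral>\<^sup>+w. ennreal (1 / \<delta>\<^sup>2) * (ennreal (norm (f w)) * indicator Q w) \<partial>lborel)"
      by (subst nn_integral_cmult) (auto simp: T(1))
    finally show "ennreal (norm (f z)) \<le> (\<integral>\<^sup>+w. ennreal (1 / \<delta>\<^sup>2) * indicator Q w * ennreal (norm (f w)) \<partial>lborel)"
      by (simp add: mult_ac)
  qed (use \<open>1 \<le> p\<close> in auto)
  also have "(\<integral>\<^sup>+w. ennreal (1 / \<delta>\<^sup>2) * indicator Q w * ennreal (norm (f w) powr p) \<partial>lborel)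
      = ennreal (1 / \<delta>\<^sup>2) * (\<integral>\<^sup>+w. ennreal (norm (f w) powr p) * indicator Q w \<partial>lborel)"
    by (subst nn_integral_cmult[symmetric]) (auto simp: mult_ac)
  finally show ?thesis
    by (simp add: Q_def mult.assoc[symmetric] ennreal_mult[symmetric])
qed

section \<open>Generalized Fock spaces\<close>

text \<open>The plane is cut according to the integer part \<open>k\<close> of
  \<open>norm z\<close>. On each piece the integrand is at most \<open>e k\<close>, the area grows
  at most quadratically, and the decay of \<open>e k\<close> wins.\<close>

lemma nn_integral_exp_neg_powr_finite:
  fixes c A :: real
  assumes "0 < c" "0 < A"
  shows "(\<integral>\<^sup>+(z::complex). ennreal (exp (- c * norm z powr A)) \<partial>lborel) < \<infinity>"
proof -
  define e where "e k = exp (- c * real k powr A)" for k :: nat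
  have "(\<integral>\<^sup>+(z::complex). ennreal (exp (- c * norm z powr A)) \<partial>lborel)
      \<le> (\<integral>\<^sup>+(z::complex). (\<Sum>k. ennreal (e k) * indicator (ball 0 (real k + 1)) z) \<partial>lborel)"
  proof (rule nn_integral_mono)
    fix z :: complex
    define k where "k = nat \<lfloor>norm z\<rfloor>"
    have k: "real k \<le> norm z" "norm z < real k + 1"
      by (auto simp: k_def)
    then have "exp (- c * norm z powr A) \<le> e k"
      using assms by (simp add: e_def powr_mono2)
    then have "ennreal (exp (- c * norm z powr A)) \<le> (\<Sum>j\<in>{k}. ennreal (e j) * indicator (ball 0 (real j + 1)) z)"
      using k by (auto intro: ennreal_leI)
    also have "\<dots> \<le> (\<Sum>j. ennreal (e j) * indicator (ball 0 (real j + 1)) z)"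
      by (rule sum_le_suminf) auto
    finally show "ennreal (exp (- c * norm z powr A)) \<le> \<dots>" .
  qed
  also have "\<dots> = (\<Sum>k. ennreal (e k) * emeasure lborel (ball (0::complex) (real k + 1)))"
  proof (subst nn_integral_suminf)
    have [measurable]: "ball (0::complex) (real k + 1) \<in> sets borel" for k by simp
    show "(\<lambda>z. ennreal (e k) * indicator (ball (0::complex) (real k + 1)) z) \<in> borel_measurable lborel" for k
      by measurable
  qed (simp add: nn_integral_cmult_indicator)
  also have "\<dots> \<le> (\<Sum>k. ennreal (e k * (4 * (real k + 1)\<^sup>2)))"
  proof (rule suminf_le)
    fix k
    have "ball (0::complex) (real k + 1) \<subseteq> cbox (Complex (- (real k + 1)) (- (real k + 1))) (Complex (real k + 1) (real k + 1))"
    proof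
      fix w :: complex assume "w \<in> ball 0 (real k + 1)"
      then show "w \<in> cbox (Complex (- (real k + 1)) (- (real k + 1))) (Complex (real k + 1) (real k + 1))"
        using abs_Re_le_cmod[of w] abs_Im_le_cmod[of w] by (auto simp: in_cbox_complex_iff)
    qed
    then have "emeasure lborel (ball (0::complex) (real k + 1))
        \<le> emeasure lborel (cbox (Complex (- (real k + 1)) (- (real k + 1))) (Complex (real k + 1) (real k + 1)))"
      by (intro emeasure_mono) auto
    also have "\<dots> = ennreal (4 * (real k + 1)\<^sup>2)"
      by (simp add: emeasure_lborel_cbox_eq Basis_complex_def power2_eq_square complex_i_not_one algebra_simps)
    finally show "ennreal (e k) * emeasure lborel (ball (0::complex) (real k + 1)) \<le> ennreal (e k * (4 * (real k + 1)\<^sup>2))"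
      by (subst ennreal_mult) (auto simp: e_def intro: mult_left_mono)
  qed auto
  also have "\<dots> < \<infinity>"
  proof -
    have "(\<lambda>k. e k * (4 * (real k + 1)\<^sup>2)) \<in> O(\<lambda>k. 1 / real k ^ 2)"
      unfolding e_def using assms by real_asymp
    then have "summable (\<lambda>k. e k * (4 * (real k + 1)\<^sup>2))"
      by (rule summable_comparison_test_bigo[rotated]) (auto simp: inverse_power_summable[of 2] divide_inverse)
    then show ?thesis
      by (subst suminf_ennreal2) (auto simp: e_def)
  qed
  finally show ?thesis .
qed

text \<open>The crude constant, from bounding a sum by twice the maximum, suffices because only
  boundedness of operators is at stake.\<close>

lemma powr_add_le:
  fixes a b p :: real
  assumes "0 \<le> a" "0 \<le> b" "0 \<le> p"
  shows "(a + b) powr p \<le> 2 powr p * (a powr p + b powr p)"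
proof -
  have "(a + b) powr p \<le> (2 * max a b) powr p"
    using assms by (intro powr_mono2) auto
  also have "\<dots> = 2 powr p * max a b powr p"
    using assms by (simp add: powr_mult)
  also have "max a b powr p \<le> a powr p + b powr p"
    by (simp add: max_def)
  finally show ?thesis by simp
qed

section \<open>The Fock space and the p-th power of its norm\<close>

locale fock =
  fixes p \<alpha> A :: real
  assumes p_ge_1: "1 \<le> p" and \<alpha>_pos: "0 < \<alpha>" and A_pos: "0 < A"
begin

abbreviation "V \<equiv> fock_space p \<alpha> A"
abbreviation "N \<equiv> fock_norm p \<alpha> A"

text \<open>The p-th power of the norm, with values in \<open>ennreal\<close> so that it is
  meaningful before membership in the space is known.\<close>

definition mass :: "(complex \<Rightarrow> complex) \<Rightarrow> ennreal" where
  "mass f = (\<integral>\<^sup>+z. ennreal ((norm (f z) * exp (- \<alpha> * norm z powr A)) powr p) \<partial>lborel)"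

lemma continuous_on_weight [continuous_intros]:
  "continuous_on S (\<lambda>z::complex. norm z powr A)"
  using A_pos by (intro continuous_on_powr') (auto intro!: continuous_intros)

lemma borel_measurable_entire: "f holomorphic_on UNIV \<Longrightarrow> f \<in> borel_measurable borel"
  by (rule borel_measurable_continuous_onI) (rule holomorphic_on_imp_continuous_on)

lemma fock_space_iff: "f \<in> V \<longleftrightarrow> f holomorphic_on UNIV \<and> mass f < \<infinity>"
proof (cases "f holomorphic_on UNIV")
  case True
  note [measurable] = borel_measurable_entire[OF True]
  show ?thesis
    using True unfolding fock_space_def mass_def
    by (simp add: integrable_iff_bounded norm_mult)
qed (simp add: fock_space_def)

lemma holomorphic_fock: "f \<in> V \<Longrightarrow> f holomorphic_on UNIV"
  by (simp add: fock_space_def)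

lemma mass_eq:
  assumes "f \<in> V"
  shows "mass f = ennreal (N f powr p)"
proof -
  have int: "integrable lborel (\<lambda>z::complex. norm (f z * of_real (exp (- \<alpha> * norm z powr A))) powr p)"
    using assms by (simp add: fock_space_def)
  have "mass f = ennreal (LINT z::complex|lborel. norm (f z * of_real (exp (- \<alpha> * norm z powr A))) powr p)"
    unfolding mass_def by (subst nn_integral_eq_integral[OF int, symmetric]) (auto simp: norm_mult)
  also have "(LINT z::complex|lborel. norm (f z * of_real (exp (- \<alpha> * norm z powr A))) powr p) = N f powr p"
    unfolding fock_norm_def using p_ge_1 by (simp add: powr_powr integral_nonneg_AE)
  finally show ?thesis .
qed

lemma fock_norm_nonneg: "0 \<le> N f"
  by (simp add: fock_norm_def)

lemma fock_space_normI:
  assumes "f holomorphic_on UNIV" "0 \<le> B" "mass f \<le> ennreal (B powr p)"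
  shows "f \<in> V" "N f \<le> B"
proof -
  show V: "f \<in> V"
    using assms by (auto simp: fock_space_iff intro: le_less_trans)
  have "N f powr p \<le> B powr p"
    using assms(3) by (simp add: mass_eq[OF V])
  then show "N f \<le> B"
    using assms(2) fock_norm_nonneg[of f] p_ge_1 powr_less_mono2[of p B "N f"] by linarith
qed

lemma mass_mono_powr:
  assumes "\<And>z. norm (f z) * exp (- \<alpha> * norm z powr A) \<le> u z"
  shows "mass f \<le> (\<integral>\<^sup>+z. ennreal (u z powr p) \<partial>lborel)"
  unfolding mass_def using assms p_ge_1
  by (intro nn_integral_mono ennreal_leI powr_mono2) auto

lemma mass_cmult:
  assumes "f holomorphic_on UNIV"
  shows "mass (\<lambda>z. c * f z) = ennreal (norm c powr p) * mass f"
proof -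
  note [measurable] = borel_measurable_entire[OF assms]
  show ?thesis
    unfolding mass_def
    by (subst nn_integral_cmult[symmetric]) (auto simp: norm_mult powr_mult ennreal_mult[symmetric] mult_ac)
qed

lemma nn_integral_powr_add_le:
  fixes u v :: "complex \<Rightarrow> real"
  assumes [measurable]: "u \<in> borel_measurable borel" "v \<in> borel_measurable borel"
    and "\<And>z. 0 \<le> u z" "\<And>z. 0 \<le> v z"
  shows "(\<integral>\<^sup>+z. ennreal ((u z + v z) powr p) \<partial>lborel)
    \<le> ennreal (2 powr p) * ((\<integral>\<^sup>+z. ennreal (u z powr p) \<partial>lborel) + (\<integral>\<^sup>+z. ennreal (v z powr p) \<partial>lborel))"
proof -
  have "(\<integral>\<^sup>+z. ennreal ((u z + v z) powr p) \<partial>lborel)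
      \<le> (\<integral>\<^sup>+z. ennreal (2 powr p) * (ennreal (u z powr p) + ennreal (v z powr p)) \<partial>lborel)"
    using assms powr_add_le p_ge_1
    by (intro nn_integral_mono) (auto simp: ennreal_plus[symmetric] ennreal_mult[symmetric] simp del: ennreal_plus intro!: ennreal_leI)
  also have "\<dots> = ennreal (2 powr p) * ((\<integral>\<^sup>+z. ennreal (u z powr p) \<partial>lborel) + (\<integral>\<^sup>+z. ennreal (v z powr p) \<partial>lborel))"
    by (simp add: nn_integral_cmult nn_integral_add)
  finally show ?thesis .
qed

lemma mass_add:
  assumes "f holomorphic_on UNIV" "h holomorphic_on UNIV"
  shows "mass (\<lambda>z. f z + h z) \<le> ennreal (2 powr p) * (mass f + mass h)"
proof -
  note [measurable] = assms[THEN borel_measurable_entire]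
  have "mass (\<lambda>z. f z + h z) \<le> (\<integral>\<^sup>+z. ennreal ((norm (f z) * exp (- \<alpha> * norm z powr A) + norm (h z) * exp (- \<alpha> * norm z powr A)) powr p) \<partial>lborel)"
    by (rule mass_mono_powr) (simp add: distrib_right[symmetric] norm_triangle_ineq)
  also have "\<dots> \<le> ennreal (2 powr p) * (mass f + mass h)"
    unfolding mass_def by (rule nn_integral_powr_add_le) auto
  finally show ?thesis .
qed

lemma fock_space_cmult: "f \<in> V \<Longrightarrow> (\<lambda>z. c * f z) \<in> V"
  by (auto simp: fock_space_iff mass_cmult ennreal_mult_less_top intro!: holomorphic_intros)

lemma nn_integral_exp_powr_finite:
  assumes "0 < c" "0 \<le> K"
  shows "(\<integral>\<^sup>+(z::complex). ennreal ((K * exp (- c * norm z powr A)) powr p) \<partial>lborel) < \<infinity>"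
proof -
  have "(\<integral>\<^sup>+(z::complex). ennreal ((K * exp (- c * norm z powr A)) powr p) \<partial>lborel)
      \<le> (\<integral>\<^sup>+(z::complex). ennreal (K powr p) * ennreal (exp (- (c * p) * norm z powr A)) \<partial>lborel)"
  proof (rule nn_integral_mono)
    fix z :: complex
    show "ennreal ((K * exp (- c * norm z powr A)) powr p) \<le> ennreal (K powr p) * ennreal (exp (- (c * p) * norm z powr A))"
      by (simp add: powr_def ln_mult exp_add[symmetric] ennreal_mult[symmetric] algebra_simps)
  qed
  also have "\<dots> = ennreal (K powr p) * (\<integral>\<^sup>+(z::complex). ennreal (exp (- (c * p) * norm z powr A)) \<partial>lborel)"
    using A_pos by (intro nn_integral_cmult) measurable
  also have "\<dots> < \<infinity>"
    using assms p_ge_1 A_pos nn_integral_exp_neg_powr_finite[of "c * p" A] by (simp add: ennreal_mult_less_top)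
  finally show ?thesis .
qed

lemma const_in_fock_space: "(\<lambda>_. k) \<in> V"
proof -
  have "mass (\<lambda>_. k) < \<infinity>"
    unfolding mass_def using nn_integral_exp_powr_finite[OF \<alpha>_pos norm_ge_zero, of k] by simp
  then show ?thesis by (simp add: fock_space_iff)
qed

text \<open>The mean value inequality on a square whose points have modulus at most
  \<open>norm z + 4 * \<delta>\<close>, which bounds the cost of the weight. The size
  \<open>\<delta>\<close> stays free: 1 is enough for the growth of \<open>G\<close>, while a value
  shrinking with \<open>norm z\<close> gives the sharp exponential needed on the boundary of the
  disc.\<close>

lemma fock_pointwise_bound:
  assumes f: "f \<in> V" and \<delta>: "0 < \<delta>" "\<delta> \<le> 1"
  shows "norm (f z) \<le> 16 / \<delta>\<^sup>2 * exp (\<alpha> * (norm z + 4 * \<delta>) powr A) * N f"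
proof -
  note hol = holomorphic_fock[OF f]
  note [measurable] = borel_measurable_entire[OF hol]
  define Q where "Q = {w. \<bar>Re w - Re z\<bar> \<le> 2 * \<delta> \<and> \<bar>Im w - Im z\<bar> \<le> 2 * \<delta>}"
  define E where "E = exp (\<alpha> * (norm z + 4 * \<delta>) powr A)"
  have "(\<integral>\<^sup>+w. ennreal (norm (f w) powr p) * indicator Q w \<partial>lborel)
      \<le> (\<integral>\<^sup>+w. ennreal (E powr p) * ennreal ((norm (f w) * exp (- \<alpha> * norm w powr A)) powr p) \<partial>lborel)"
  proof (rule nn_integral_mono)
    fix w
    show "ennreal (norm (f w) powr p) * indicator Q w \<le> ennreal (E powr p) * ennreal ((norm (f w) * exp (- \<alpha> * norm w powr A)) powr p)"
    proof (cases "w \<in> Q")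
      case True
      have "norm (w - z) \<le> \<bar>Re (w - z)\<bar> + \<bar>Im (w - z)\<bar>"
        by (rule cmod_le)
      then have "norm w \<le> norm z + 4 * \<delta>"
        using True norm_triangle_sub[of w z] by (simp add: Q_def)
      then have "\<alpha> * norm w powr A \<le> \<alpha> * (norm z + 4 * \<delta>) powr A"
        using \<alpha>_pos A_pos by (intro mult_left_mono powr_mono2) auto
      then have "1 \<le> E * exp (- \<alpha> * norm w powr A)"
        by (simp add: E_def exp_add[symmetric])
      then have "norm (f w) * 1 \<le> norm (f w) * (E * exp (- \<alpha> * norm w powr A))"
        by (rule mult_left_mono) simp
      then have "norm (f w) powr p \<le> (E * (norm (f w) * exp (- \<alpha> * norm w powr A))) powr p"
        using p_ge_1 by (intro powr_mono2) (auto simp: mult_ac)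
      then show ?thesis
        using True by (auto simp: powr_mult E_def ennreal_mult[symmetric] intro!: ennreal_leI)
    qed simp
  qed
  also have "\<dots> = ennreal (E powr p) * mass f"
    unfolding mass_def by (rule nn_integral_cmult) measurable
  also have "\<dots> = ennreal ((E * N f) powr p)"
    by (simp add: mass_eq[OF f] powr_mult E_def fock_norm_nonneg ennreal_mult[symmetric])
  finally have "ennreal (norm (f z) powr p) \<le> ennreal (16 powr (p - 1) / \<delta>\<^sup>2) * ennreal ((E * N f) powr p)"
    unfolding Q_def by (intro order_trans[OF norm_powr_le_nn_integral_square[OF hol \<delta>(1) p_ge_1]] mult_left_mono) auto
  then have "norm (f z) powr p \<le> 16 powr (p - 1) / \<delta>\<^sup>2 * (E * N f) powr p"
    by (subst (asm) ennreal_mult[symmetric]) (auto simp: ennreal_le_iff)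
  \<comment> \<open>As \<open>1 / \<delta>\<^sup>2\<close> is at least 1, it may be raised to the
    power \<open>p\<close>; the whole bound is then a p-th power and the root can be taken.\<close>
  also have "\<dots> \<le> (16 / \<delta>\<^sup>2) powr p * (E * N f) powr p"
  proof (rule mult_right_mono)
    have "1 \<le> 1 / \<delta>\<^sup>2"
      using \<delta> by (simp add: power_le_one)
    then have "(1 / \<delta>\<^sup>2) powr 1 \<le> (1 / \<delta>\<^sup>2) powr p"
      using p_ge_1 by (intro powr_mono) auto
    then have "16 powr (p - 1) * (1 / \<delta>\<^sup>2) \<le> 16 powr p * (1 / \<delta>\<^sup>2) powr p"
      using \<delta> by (intro mult_mono powr_mono) auto
    then show "16 powr (p - 1) / \<delta>\<^sup>2 \<le> (16 / \<delta>\<^sup>2) powr p"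
      using \<delta> by (simp add: powr_divide)
  qed simp
  also have "\<dots> = (16 / \<delta>\<^sup>2 * E * N f) powr p"
    using \<delta> fock_norm_nonneg[of f] by (simp add: powr_mult[symmetric] E_def mult_ac)
  finally have "norm (f z) \<le> 16 / \<delta>\<^sup>2 * E * N f"
    using \<delta> fock_norm_nonneg[of f] p_ge_1 powr_less_mono2[of p "16 / \<delta>\<^sup>2 * E * N f" "norm (f z)"]
    by (fastforce simp: E_def)
  then show ?thesis by (simp add: E_def)
qed

end

section \<open>The Volterra operator and its symbol\<close>

lemma contour_integral_linepath_primitive:
  fixes F k :: "complex \<Rightarrow> complex"
  assumes "\<And>z. (F has_field_derivative k z) (at z)"
  shows "contour_integral (linepath a b) k = F b - F a"
  using contour_integral_primitive[of UNIV F k "linepath a b"] assms by (simp add: contour_integral_unique)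

text \<open>An entire function has a primitive, and the integral is a difference of two of its
  values.\<close>

lemma has_field_derivative_contour_integral_linepath:
  fixes k :: "complex \<Rightarrow> complex"
  assumes "k holomorphic_on UNIV"
  shows "((\<lambda>z. contour_integral (linepath a z) k) has_field_derivative k z) (at z)"
proof -
  obtain F where F: "\<And>z. (F has_field_derivative k z) (at z)"
    using holomorphic_convex_primitive'[of UNIV k] assms by auto
  then show ?thesis
    by (auto simp: contour_integral_linepath_primitive[OF F] intro!: derivative_eq_intros)
qed

lemma has_field_derivative_entire: "f holomorphic_on UNIV \<Longrightarrow> (f has_field_derivative deriv f z) (at z)"
  by (rule holomorphic_derivI[of f UNIV]) auto

lemma has_field_derivative_volterra:
  assumes "f holomorphic_on UNIV" "g holomorphic_on UNIV"
  shows "(volterra g f has_field_derivative f z * deriv g z) (at z)"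
proof -
  have "(\<lambda>\<zeta>. f \<zeta> * deriv g \<zeta>) holomorphic_on UNIV"
    using assms by (auto intro!: holomorphic_intros)
  from has_field_derivative_contour_integral_linepath[OF this, of 0 z] show ?thesis
    by (simp add: volterra_def[abs_def])
qed

lemma volterra_0 [simp]: "volterra g f 0 = 0"
  by (simp add: volterra_def)

text \<open>Characterises \<open>volterra g f\<close> as the primitive of \<open>f * deriv g\<close>
  that vanishes at 0. Explicit evaluations of the operator go through this rule.\<close>

lemma volterra_eqI:
  assumes "\<And>z. (F has_field_derivative f z * deriv g z) (at z)" "F 0 = 0"
  shows "volterra g f = F"
  using contour_integral_linepath_primitive[OF assms(1), of 0] assms(2) by (auto simp: volterra_def)

lemma eq_if_has_field_derivative_eq:
  fixes F H :: "complex \<Rightarrow> complex"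
  assumes "\<And>z. (F has_field_derivative d z) (at z)" "\<And>z. (H has_field_derivative d z) (at z)" "F a = H a"
  shows "F = H"
proof
  fix z
  have "F z - F a = H z - H a"
    using contour_integral_linepath_primitive[OF assms(1), of a z] contour_integral_linepath_primitive[OF assms(2), of a z] by simp
  then show "F z = H z" using assms(3) by simp
qed

text \<open>Differentiation gives \<open>f' = f * g' / \<mu>\<close>, so
  \<open>f * exp (- g / \<mu>)\<close> is constant, and its value at 0 is 0. Thus
  \<open>\<mu> - T\<close> is injective on all entire functions, inside or outside the Fock
  space.\<close>

lemma volterra_eigen_zero:
  assumes hol: "f holomorphic_on UNIV" "g holomorphic_on UNIV" and "\<mu> \<noteq> 0"
    and eq: "\<And>z. \<mu> * f z = volterra g f z"
  shows "f z = 0"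
proof -
  have f0: "f 0 = 0" using eq[of 0] \<open>\<mu> \<noteq> 0\<close> by simp
  have "((\<lambda>z. volterra g f z / \<mu>) has_field_derivative f z * deriv g z / \<mu>) (at z)" for z
    by (rule DERIV_cdivide[OF has_field_derivative_volterra[OF hol]])
  moreover have "(\<lambda>z. volterra g f z / \<mu>) = f"
    using eq \<open>\<mu> \<noteq> 0\<close> by (auto simp: fun_eq_iff field_simps)
  ultimately have df: "(f has_field_derivative f z * deriv g z / \<mu>) (at z)" for z
    by simp
  have "((\<lambda>z. f z * exp (- g z / \<mu>)) has_field_derivative 0) (at z)" for z
    by (rule derivative_eq_intros df has_field_derivative_entire[OF hol(2)] refl \<open>\<mu> \<noteq> 0\<close>)+
       (use \<open>\<mu> \<noteq> 0\<close> in \<open>simp add: field_simps\<close>)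
  then have "(\<lambda>z. f z * exp (- g z / \<mu>)) = (\<lambda>z. 0)"
    by (rule eq_if_has_field_derivative_eq[where a = 0]) (auto simp: f0)
  then show ?thesis by (metis exp_not_eq_zero mult_eq_0_iff)
qed

text \<open>Boundedness of the operator is the assumption here; that \<open>g\<close> is a
  polynomial of degree at most \<open>A\<close> is derived from it in \<open>g_eq\<close>.\<close>

locale volterra_fock = fock +
  fixes g :: "complex \<Rightarrow> complex"
  assumes g_hol: "g holomorphic_on UNIV"
    and T_bounded: "bounded_operator_on V N (volterra g)"
begin

abbreviation "T \<equiv> volterra g"

definition G :: "complex \<Rightarrow> complex" where "G z = g z - g 0"

text \<open>The Taylor coefficients of \<open>g\<close> at 0. When \<open>A = real n\<close>, the
  number \<open>b\<close> of the theorem is \<open>c n\<close>.\<close>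

definition c :: "nat \<Rightarrow> complex" where "c k = (deriv ^^ k) g 0 / fact k"

lemma G_hol: "G holomorphic_on S"
  unfolding G_def[abs_def] using g_hol by (auto intro!: holomorphic_intros intro: holomorphic_on_subset)

lemma has_field_derivative_g: "(g has_field_derivative deriv g z) (at z)"
  by (rule has_field_derivative_entire[OF g_hol])

lemma has_field_derivative_G: "(G has_field_derivative deriv g z) (at z)"
  unfolding G_def[abs_def] by (auto intro!: derivative_eq_intros has_field_derivative_g)

lemma T_in_fock_space: "f \<in> V \<Longrightarrow> T f \<in> V"
  using T_bounded by (simp add: bounded_operator_on_def)

section \<open>Boundedness forces a polynomial symbol\<close>

lemma volterra_iterate_one: "(T ^^ k) (\<lambda>_. 1) = (\<lambda>z. G z ^ k / fact k)"
proof (induction k)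
  case (Suc k)
  have eq: "of_nat (Suc k) * x / fact (Suc k) = x / fact k" for x :: complex
    unfolding fact_Suc by (simp del: of_nat_Suc)
  have "T (\<lambda>z. G z ^ k / fact k) = (\<lambda>z. G z ^ Suc k / fact (Suc k))"
  proof (rule volterra_eqI)
    fix z
    show "((\<lambda>z. G z ^ Suc k / fact (Suc k)) has_field_derivative G z ^ k / fact k * deriv g z) (at z)"
      using DERIV_cdivide[OF DERIV_power[OF has_field_derivative_G[of z], of "Suc k"], of "fact (Suc k)"]
      by (simp only: eq diff_Suc_Suc diff_zero times_divide_eq_left One_nat_def) (simp only: mult_ac)
  qed (simp add: G_def)
  then show ?case by (simp add: Suc)
qed simp

text \<open>The norm of the k-th iterate on 1 grows at most geometrically, so the pointwise estimate
  bounds \<open>norm (G z) ^ k\<close> by \<open>fact k\<close> times a geometric term times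
  \<open>exp (\<alpha> * (norm z + 4) powr A)\<close>. For \<open>k\<close> near
  \<open>(norm z + 4) powr A\<close> the exponential is geometric as well, and the k-th root leaves
  a multiple of \<open>k\<close>.\<close>

lemma G_growth: "\<exists>D\<ge>0. \<forall>z. norm (G z) \<le> D * ((norm z + 4) powr A + 1)"
proof -
  obtain C0 where C0: "\<And>f. f \<in> V \<Longrightarrow> N (T f) \<le> C0 * N f"
    using T_bounded unfolding bounded_operator_on_def by blast
  define C where "C = max 1 C0"
  have C: "N (T f) \<le> C * N f" if "f \<in> V" for f
    using mult_right_mono[of C0 C "N f"] C0[OF that] fock_norm_nonneg[of f] by (simp add: C_def)
  have iter: "(T ^^ k) (\<lambda>_. 1) \<in> V \<and> N ((T ^^ k) (\<lambda>_. 1)) \<le> C ^ k * N (\<lambda>_. 1)" for k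
  proof (induction k)
    case 0
    show ?case using const_in_fock_space[of 1] by simp
  next
    case (Suc k)
    have "N (T ((T ^^ k) (\<lambda>_. 1))) \<le> C * N ((T ^^ k) (\<lambda>_. 1))"
      using Suc by (intro C) auto
    also have "\<dots> \<le> C * (C ^ k * N (\<lambda>_. 1))"
      using Suc by (intro mult_left_mono) (auto simp: C_def)
    finally show ?case using Suc T_in_fock_space by simp
  qed
  \<comment> \<open>The maximum with 1 ensures \<open>M \<le> M ^ k\<close>, so that this constant
    also joins the k-th power.\<close>
  define M where "M = max 1 (16 * N (\<lambda>_. 1))"
  define D where "D = M * exp \<alpha> * C"
  have "norm (G z) \<le> D * ((norm z + 4) powr A + 1)" for z
  proof -
    define \<rho> where "\<rho> = (norm z + 4) powr A"
    \<comment> \<open>Rounding up gives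
      \<open>exp (\<alpha> * \<rho>) \<le> exp \<alpha> ^ k\<close> and, since \<open>\<rho>\<close>
      is positive, \<open>k \<ge> 1\<close>.\<close>
    define k where "k = nat \<lceil>\<rho>\<rceil>"
    have "norm z + 4 > 0" by (simp add: add_nonneg_pos)
    then have "\<rho> > 0" by (simp add: \<rho>_def)
    then have k: "\<rho> \<le> real k" "real k \<le> \<rho> + 1" "k \<ge> 1"
      by (auto simp: k_def) linarith+
    have "norm (G z) ^ k / fact k = norm ((T ^^ k) (\<lambda>_. 1) z)"
      by (simp add: volterra_iterate_one norm_divide norm_power)
    also have "\<dots> \<le> 16 / 1\<^sup>2 * exp (\<alpha> * (norm z + 4 * 1) powr A) * N ((T ^^ k) (\<lambda>_. 1))"
      using iter[of k] by (intro fock_pointwise_bound) auto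
    also have "\<dots> \<le> 16 * exp (\<alpha> * real k) * (C ^ k * N (\<lambda>_. 1))"
      using iter[of k] k \<alpha>_pos fock_norm_nonneg by (intro mult_mono) (auto simp: \<rho>_def C_def)
    also have "\<dots> = 16 * N (\<lambda>_. 1) * (exp \<alpha> * C) ^ k"
      by (simp add: exp_of_nat_mult[symmetric] power_mult_distrib mult_ac)
    also have "\<dots> \<le> M * (exp \<alpha> * C) ^ k"
      by (intro mult_right_mono) (auto simp: M_def C_def)
    also have "\<dots> \<le> M ^ k * (exp \<alpha> * C) ^ k"
      using self_le_power[of M k] k by (intro mult_right_mono) (auto simp: M_def C_def)
    also have "\<dots> = D ^ k" by (simp add: D_def power_mult_distrib mult_ac)
    finally have "norm (G z) ^ k \<le> D ^ k * fact k"
      by (simp add: field_simps)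
    also have "\<dots> \<le> D ^ k * real k ^ k"
      using fact_le_power[of k, where 'a = real] by (intro mult_left_mono) (auto simp: D_def M_def C_def)
    also have "\<dots> = (D * real k) ^ k" by (simp add: power_mult_distrib)
    finally have "norm (G z) \<le> D * real k"
      using k by (subst (asm) power_mono_iff) (auto simp: D_def M_def C_def)
    also have "\<dots> \<le> D * (\<rho> + 1)"
      using k by (intro mult_left_mono) (auto simp: D_def M_def C_def)
    finally show ?thesis by (simp add: \<rho>_def)
  qed
  moreover have "D \<ge> 0" by (simp add: D_def M_def C_def)
  ultimately show ?thesis by blast
qed

text \<open>Cauchy's estimate on circles of radius tending to infinity, against growth of order
  \<open>A < k\<close>.\<close>

lemma coeff_eq_0:
  assumes "A < real k"
  shows "c k = 0"
proof -
  obtain D where D: "D \<ge> 0" "\<And>z. norm (G z) \<le> D * ((norm z + 4) powr A + 1)"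
    using G_growth by blast
  define B where "B r = norm (g 0) + D * ((r + 4) powr A + 1)" for r
  have "norm (c k) \<le> B r / r ^ k" if "r > 0" for r :: real
  proof -
    have "norm ((deriv ^^ k) g 0) \<le> fact k * B r / r ^ k"
    proof (rule Cauchy_inequality)
      show "g holomorphic_on ball 0 r" "continuous_on (cball 0 r) g"
        using g_hol by (auto intro: holomorphic_on_subset holomorphic_on_imp_continuous_on)
      fix x :: complex assume "norm (0 - x) = r"
      moreover have "norm (g x) \<le> norm (g 0) + norm (G x)"
        using norm_triangle_ineq[of "g 0" "G x"] by (simp add: G_def)
      ultimately show "norm (g x) \<le> B r"
        using D(2)[of x] by (simp add: B_def)
    qed fact
    then show ?thesis
      by (simp add: c_def norm_divide field_simps)
  qed
  then have "\<forall>\<^sub>F r in at_top. norm (c k) \<le> B r / r powr real k"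
    by (intro eventually_mono[OF eventually_gt_at_top[of 0]]) (simp add: powr_realpow)
  moreover have "((\<lambda>r. B r / r powr real k) \<longlongrightarrow> 0) at_top"
    unfolding B_def using assms A_pos by real_asymp
  ultimately have "norm (c k) \<le> 0"
    by (intro tendsto_lowerbound[where F = "at_top :: real filter"]) auto
  then show ?thesis by simp
qed

definition m :: nat where "m = nat \<lfloor>A\<rfloor>"

lemma m_le: "real m \<le> A"
  using A_pos by (simp add: m_def)

lemma g_eq: "g z = (\<Sum>k\<le>m. c k * z ^ k)"
proof -
  have "((\<lambda>k. (deriv ^^ k) g 0 / fact k * (z - 0) ^ k) sums g z)"
    by (rule holomorphic_power_series[of g 0 "norm z + 1"]) (auto intro: holomorphic_on_subset[OF g_hol])
  then have "(\<lambda>k. c k * z ^ k) sums g z" by (simp add: c_def)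
  moreover have "c k = 0" if "k > m" for k
  proof (rule coeff_eq_0)
    have "A < real m + 1" unfolding m_def using A_pos by linarith
    then show "A < real k" using that by linarith
  qed
  then have "(\<lambda>k. c k * z ^ k) sums (\<Sum>k\<le>m. c k * z ^ k)"
    by (intro sums_finite) auto
  ultimately show ?thesis by (rule sums_unique2)
qed

lemma deriv_g_eq: "deriv g z = (\<Sum>k\<le>m. c k * (of_nat k * z ^ (k - 1)))"
proof (rule DERIV_imp_deriv)
  have "((\<lambda>z. \<Sum>k\<le>m. c k * z ^ k) has_field_derivative (\<Sum>k\<le>m. c k * (of_nat k * z ^ (k - 1)))) (at z)"
    by (rule DERIV_sum) (use DERIV_cmult[OF DERIV_power[OF DERIV_ident]] in simp)
  moreover have "(\<lambda>z. \<Sum>k\<le>m. c k * z ^ k) = g"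
    by (rule ext) (rule g_eq[symmetric])
  ultimately show "(g has_field_derivative (\<Sum>k\<le>m. c k * (of_nat k * z ^ (k - 1)))) (at z)"
    by (simp only:)
qed

text \<open>Every \<open>T f\<close> vanishes at 0, so the constant 1 is not in the range of
  \<open>T\<close>.\<close>

lemma zero_in_spectrum: "0 \<in> operator_spectrum V N T"
proof -
  have "\<not> (\<forall>f\<in>V. (\<lambda>z. 0 * S f z - T (S f) z) = f)" for S
  proof
    assume "\<forall>f\<in>V. (\<lambda>z. 0 * S f z - T (S f) z) = f"
    from bspec[OF this const_in_fock_space[of 1], THEN fun_cong, of 0] show False by simp
  qed
  then show ?thesis by (auto simp: operator_spectrum_def)
qed

end

section \<open>Points of the closed disc are in the spectrum\<close>

text \<open>Averaging over the \<open>n\<close>-th roots of unity kills every monomial except the top one.\<close>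

lemma exists_Re_poly_ge:
  fixes a :: "nat \<Rightarrow> complex"
  assumes "1 \<le> n" "0 < r"
  shows "\<exists>z. norm z = r \<and> norm (a n) * r ^ n \<le> Re (\<Sum>k=1..n. a k * z ^ k)"
proof (rule ccontr)
  define P where "P z = (\<Sum>k=1..n. a k * z ^ k)" for z
  \<comment> \<open>The argument is chosen so that \<open>a n * z0 ^ n\<close> is real and
    nonnegative.\<close>
  define z0 where "z0 = rcis r (- Arg (a n) / n)"
  define w where "w = exp (2 * of_real pi * \<i> * of_nat 1 / of_nat n)"
  assume "\<not> ?thesis"
  then have less: "Re (P z) < norm (a n) * r ^ n" if "norm z = r" for z
    using that by (force simp: P_def not_le)
  have wn: "w ^ k = exp (2 * of_real pi * \<i> * of_nat k / of_nat n)" for k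
    by (simp add: w_def exp_of_nat_mult[symmetric] algebra_simps)
  have top: "a n * z0 ^ n = of_real (norm (a n) * r ^ n)"
  proof -
    have "a n * z0 ^ n = rcis (norm (a n)) (Arg (a n)) * rcis (r ^ n) (- Arg (a n))"
      using assms unfolding z0_def rcis_cmod_Arg DeMoivre2 by simp
    then show ?thesis by (simp only: rcis_mult) (simp add: rcis_def)
  qed
  \<comment> \<open>The points \<open>w ^ l * z0\<close> are the rotations of \<open>z0\<close> by
    the n-th roots of unity. For \<open>k < n\<close> the inner geometric sum is 0; for
    \<open>k = n\<close> it is \<open>n\<close>.\<close>
  have "(\<Sum>l<n. P (w ^ l * z0)) = (\<Sum>k=1..n. a k * z0 ^ k * (\<Sum>l<n. (w ^ k) ^ l))"
    unfolding P_def by (subst sum.swap) (auto simp: sum_distrib_left power_mult_distrib power_mult[symmetric] mult_ac intro!: sum.cong)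
  also have "\<dots> = (\<Sum>k\<in>{n}. a k * z0 ^ k * (\<Sum>l<n. (w ^ k) ^ l))"
  proof (rule sum.mono_neutral_right)
    show "\<forall>k\<in>{1..n} - {n}. a k * z0 ^ k * (\<Sum>l<n. (w ^ k) ^ l) = 0"
    proof
      fix k assume k: "k \<in> {1..n} - {n}"
      then have "w ^ k \<noteq> 1"
        unfolding wn using assms by (subst complex_root_unity_eq_1) (auto dest: dvd_imp_le)
      moreover have "(w ^ k) ^ n = 1"
        unfolding power_mult[symmetric] mult.commute[of k n] unfolding power_mult wn[of n] using assms by simp
      ultimately have "(\<Sum>l<n. (w ^ k) ^ l) = 0"
        by (simp add: geometric_sum)
      then show "a k * z0 ^ k * (\<Sum>l<n. (w ^ k) ^ l) = 0" by simp
    qed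
  qed (use assms in auto)
  also have "\<dots> = of_real (norm (a n) * r ^ n) * of_nat n"
  proof -
    have "w ^ n = 1" unfolding wn using assms by simp
    then show ?thesis using top by simp
  qed
  finally have "(\<Sum>l<n. Re (P (w ^ l * z0))) = norm (a n) * r ^ n * n"
    by (simp add: Re_sum[symmetric])
  moreover have "(\<Sum>l<n. Re (P (w ^ l * z0))) < (\<Sum>l<n. norm (a n) * r ^ n)"
  proof (rule sum_strict_mono)
    fix l
    have "norm (w ^ l * z0) = r"
      using assms unfolding wn by (simp add: norm_mult z0_def)
    then show "Re (P (w ^ l * z0)) < norm (a n) * r ^ n" by (rule less)
  qed (use assms in \<open>auto simp: lessThan_empty_iff\<close>)
  ultimately show False by simp
qed

text \<open>Enlarging the radius by \<open>4 / r ^ (n - 1)\<close> raises the n-th power by a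
  bounded amount only. Hence the weight in the pointwise estimate loses just a constant factor at
  that scale.\<close>

lemma power_add_le_power_plus_const:
  fixes r :: real
  assumes "1 \<le> r" "1 \<le> n"
  shows "(r + 4 * (1 / r ^ (n - 1))) ^ n \<le> r ^ n + 4 * real n * exp (4 * real n)"
proof -
  define y where "y = 4 / r ^ n"
  have rn: "1 \<le> r ^ n" using assms by simp
  have y: "0 \<le> y" "y \<le> 4" using rn by (auto simp: y_def field_simps)
  have "r + 4 * (1 / r ^ (n - 1)) = r * (1 + y)"
    using assms by (cases n) (auto simp: y_def field_simps)
  then have "(r + 4 * (1 / r ^ (n - 1))) ^ n = r ^ n * (1 + y) ^ n"
    by (simp add: power_mult_distrib)
  also have "(1 + y) ^ n \<le> exp y ^ n"
    using y by (intro power_mono exp_ge_add_one_self) auto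
  also have "exp y ^ n = exp (real n * y)"
    by (simp add: exp_of_nat_mult)
  \<comment> \<open>The inequality \<open>exp x \<le> 1 + x * exp x\<close>, a rearrangement of
    \<open>1 - x \<le> exp (- x)\<close>.\<close>
  also have "exp (real n * y) \<le> 1 + real n * y * exp (real n * y)"
  proof -
    have "(1 - real n * y) * exp (real n * y) \<le> exp (- (real n * y)) * exp (real n * y)"
      using exp_ge_add_one_self[of "- (real n * y)"] by (intro mult_right_mono) auto
    then show ?thesis by (simp add: exp_minus algebra_simps)
  qed
  also have "\<dots> \<le> 1 + real n * y * exp (4 * real n)"
  proof (intro add_left_mono mult_left_mono)
    show "exp (real n * y) \<le> exp (4 * real n)"
      using mult_left_mono[OF y(2), of "real n"] by (simp add: mult.commute)
  qed (use y in auto)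
  finally have "(r + 4 * (1 / r ^ (n - 1))) ^ n \<le> r ^ n * (1 + real n * y * exp (4 * real n))"
    using rn by simp
  also have "\<dots> = r ^ n + 4 * real n * exp (4 * real n)"
    using assms by (simp add: y_def field_simps)
  finally show ?thesis .
qed

context volterra_fock
begin

lemma volterra_diff:
  assumes "f holomorphic_on UNIV" "h holomorphic_on UNIV"
  shows "T (\<lambda>z. f z - h z) = (\<lambda>z. T f z - T h z)"
  by (rule volterra_eqI)
     (auto intro!: derivative_eq_intros has_field_derivative_volterra assms g_hol simp: algebra_simps)

definition W :: "complex \<Rightarrow> complex \<Rightarrow> complex" where "W \<mu> z = exp (G z / \<mu>)"

lemma W_hol: "W \<mu> holomorphic_on S"
  unfolding W_def[abs_def] divide_inverse by (intro holomorphic_intros G_hol)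

lemma has_field_derivative_W: "(W \<mu> has_field_derivative W \<mu> z * deriv g z / \<mu>) (at z)"
  unfolding W_def[abs_def] divide_inverse by (auto intro!: derivative_eq_intros has_field_derivative_G)

text \<open>The pointwise estimate at scale \<open>1 / r ^ (n - 1)\<close> loses a factor of at most
  \<open>(r ^ n)\<^sup>2\<close> against \<open>exp (\<alpha> * r ^ n)\<close>. The third power of
  \<open>G\<close> is therefore enough to violate it, even when \<open>norm \<mu>\<close> equals the
  bound and \<open>W\<close> alone need not grow faster than the weight.\<close>

lemma norm_le_spectral_bound_in_spectrum:
  assumes An: "A = real n" and "\<mu> \<noteq> 0" and \<mu>: "norm \<mu> \<le> norm (c n) / \<alpha>"
  shows "\<mu> \<in> operator_spectrum V N T"
proof (rule ccontr)
  assume "\<mu> \<notin> operator_spectrum V N T"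
  then obtain S where S: "bounded_operator_on V N S" "\<And>f. f \<in> V \<Longrightarrow> (\<lambda>z. \<mu> * S f z - T (S f) z) = f"
    unfolding operator_spectrum_def by blast
  have "n \<ge> 1" using An A_pos by auto
  have "m = n" unfolding m_def unfolding An by simp
  \<comment> \<open>Both \<open>F\<close> and \<open>S h\<close> are entire solutions of the same
    equation, so injectivity on entire functions identifies them and puts \<open>F\<close> into the
    space.\<close>
  have solution: "F \<in> V" if F: "F holomorphic_on UNIV" and h: "h \<in> V" and eq: "\<And>z. \<mu> * F z - T F z = h z" for F h
  proof -
    have Sh: "S h \<in> V" using S(1) h by (simp add: bounded_operator_on_def)
    note Shol = holomorphic_fock[OF Sh]
    have "F z - S h z = 0" for z
    proof (rule volterra_eigen_zero[OF _ g_hol \<open>\<mu> \<noteq> 0\<close>, where f = "\<lambda>z. F z - S h z"])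
      show "(\<lambda>z. F z - S h z) holomorphic_on UNIV" by (intro holomorphic_intros F Shol)
      fix z show "\<mu> * (F z - S h z) = T (\<lambda>z. F z - S h z) z"
        using eq[of z] fun_cong[OF S(2)[OF h], of z] unfolding volterra_diff[OF F Shol] by (simp add: algebra_simps)
    qed
    then have "F = S h" by (simp add: fun_eq_iff)
    with Sh show ?thesis by simp
  qed
  define u where "u k z = W \<mu> z * G z ^ k" for k z
  have uS: "u (Suc k) = (\<lambda>z. W \<mu> z * G z ^ Suc k)" for k
    by (simp add: u_def fun_eq_iff)
  have u_hol: "u k holomorphic_on UNIV" for k
    unfolding u_def[abs_def] by (intro holomorphic_intros W_hol G_hol)
  have u_in: "u k \<in> V" for k
  proof (induction k)
    case 0
    have "T (u 0) = (\<lambda>z. \<mu> * u 0 z - \<mu>)"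
      by (rule volterra_eqI)
         (use \<open>\<mu> \<noteq> 0\<close> in \<open>auto simp: u_def W_def[of \<mu> 0] G_def[of 0] intro!: derivative_eq_intros has_field_derivative_W\<close>)
    then show ?case
      by (intro solution[OF u_hol const_in_fock_space[of \<mu>]]) simp
  next
    case (Suc k)
    have "T (u (Suc k)) = (\<lambda>z. \<mu> * u (Suc k) z - \<mu> * of_nat (Suc k) * T (u k) z)"
    proof (rule volterra_eqI)
      fix z
      have "((\<lambda>z. \<mu> * (W \<mu> z * G z ^ Suc k) - \<mu> * of_nat (Suc k) * T (u k) z) has_field_derivative
         \<mu> * (W \<mu> z * ((1 + of_nat k) * (deriv g z * G z ^ k)) + W \<mu> z * deriv g z / \<mu> * G z ^ Suc k)
           - \<mu> * of_nat (Suc k) * (u k z * deriv g z)) (at z)"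
        by (intro DERIV_diff DERIV_cmult DERIV_mult' has_field_derivative_W DERIV_power_Suc has_field_derivative_G
             has_field_derivative_volterra u_hol g_hol)
      also have "\<mu> * (W \<mu> z * ((1 + of_nat k) * (deriv g z * G z ^ k)) + W \<mu> z * deriv g z / \<mu> * G z ^ Suc k)
           - \<mu> * of_nat (Suc k) * (u k z * deriv g z) = u (Suc k) z * deriv g z"
        using \<open>\<mu> \<noteq> 0\<close> by (simp add: u_def algebra_simps)
      finally show "((\<lambda>z. \<mu> * u (Suc k) z - \<mu> * of_nat (Suc k) * T (u k) z) has_field_derivative u (Suc k) z * deriv g z) (at z)"
        by (simp only: uS)
    qed (simp add: u_def G_def)
    then show ?case
      by (intro solution[OF u_hol fock_space_cmult[OF T_in_fock_space[OF Suc], of "\<mu> * of_nat (Suc k)"]]) simp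
  qed
  define K where "K = 16 * exp (\<alpha> * (4 * real n * exp (4 * real n))) * N (u 3)"
  define q where "q = (norm \<mu> * \<alpha>) ^ 3"
  have "K \<ge> 0" by (simp add: K_def fock_norm_nonneg)
  have "q > 0" using \<open>\<mu> \<noteq> 0\<close> \<alpha>_pos by (simp add: q_def)
  \<comment> \<open>After \<open>exp (\<alpha> * r ^ n)\<close> cancels, a cube of
    \<open>r ^ n\<close> stands against a square; the surviving factor cannot stay bounded.\<close>
  have bound: "q * r \<le> K" if "1 \<le> r" for r :: real
  proof -
    obtain z where z: "norm z = r" and Re: "norm (c n / \<mu>) * r ^ n \<le> Re (\<Sum>k=1..n. c k / \<mu> * z ^ k)"
      using exists_Re_poly_ge[of n r "\<lambda>k. c k / \<mu>"] \<open>n \<ge> 1\<close> \<open>1 \<le> r\<close> by auto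
    have "G z = (\<Sum>k\<in>{..n} - {0}. c k * z ^ k)"
      unfolding G_def g_eq[of z] \<open>m = n\<close> by (subst sum_diff1) (auto simp: c_def)
    also have "{..n} - {0} = {1..n}" by auto
    finally have Gz: "G z / \<mu> = (\<Sum>k=1..n. c k / \<mu> * z ^ k)"
      by (simp add: sum_divide_distrib)
    have "\<alpha> \<le> norm (c n / \<mu>)"
      using \<mu> \<open>\<mu> \<noteq> 0\<close> \<alpha>_pos by (simp add: norm_divide field_simps)
    then have "\<alpha> * r ^ n \<le> norm (c n / \<mu>) * r ^ n"
      using \<open>1 \<le> r\<close> by (intro mult_right_mono) auto
    then have R: "\<alpha> * r ^ n \<le> Re (G z / \<mu>)" using Re Gz by simp
    then have "\<alpha> * r ^ n \<le> norm (G z / \<mu>)"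
      using complex_Re_le_cmod order_trans by blast
    then have Gn: "norm \<mu> * \<alpha> * r ^ n \<le> norm (G z)"
      using \<open>\<mu> \<noteq> 0\<close> by (simp add: norm_divide field_simps)
    have "exp (\<alpha> * r ^ n) * (norm \<mu> * \<alpha> * r ^ n) ^ 3 \<le> norm (W \<mu> z) * norm (G z) ^ 3"
      using R Gn \<alpha>_pos \<open>1 \<le> r\<close> by (intro mult_mono power_mono) (auto simp: W_def)
    also have "\<dots> = norm (u 3 z)"
      by (simp add: u_def norm_mult norm_power)
    also have "\<dots> \<le> 16 / (1 / r ^ (n - 1))\<^sup>2 * exp (\<alpha> * (norm z + 4 * (1 / r ^ (n - 1))) powr A) * N (u 3)"
      using \<open>1 \<le> r\<close> by (intro fock_pointwise_bound u_in) (auto simp: field_simps)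
    also have "\<dots> \<le> 16 * r ^ (2 * n) * exp (\<alpha> * (r ^ n + 4 * real n * exp (4 * real n))) * N (u 3)"
    proof (intro mult_mono)
      have "(r ^ (n - 1))\<^sup>2 \<le> r ^ (2 * n)"
        using \<open>1 \<le> r\<close> by (simp add: power_mult[symmetric] power_increasing)
      then show "16 / (1 / r ^ (n - 1))\<^sup>2 \<le> 16 * r ^ (2 * n)"
        by (simp add: power_divide)
      have "0 < r + 4 * (1 / r ^ (n - 1))"
        using \<open>1 \<le> r\<close> by (simp add: add_pos_nonneg)
      then have "(norm z + 4 * (1 / r ^ (n - 1))) powr A \<le> r ^ n + 4 * real n * exp (4 * real n)"
        using power_add_le_power_plus_const[OF \<open>1 \<le> r\<close> \<open>1 \<le> n\<close>] by (simp add: An z powr_realpow)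
      then show "exp (\<alpha> * (norm z + 4 * (1 / r ^ (n - 1))) powr A) \<le> exp (\<alpha> * (r ^ n + 4 * real n * exp (4 * real n)))"
        using \<alpha>_pos by simp
    qed (use \<open>1 \<le> r\<close> fock_norm_nonneg in auto)
    also have "\<dots> = exp (\<alpha> * r ^ n) * (K * (r ^ n)\<^sup>2)"
      by (simp add: K_def exp_add distrib_left power_mult mult.commute[of 2 n] mult_ac)
    finally have "(norm \<mu> * \<alpha> * r ^ n) ^ 3 \<le> K * (r ^ n)\<^sup>2"
      by simp
    then have "q * r ^ n * (r ^ n)\<^sup>2 \<le> K * (r ^ n)\<^sup>2"
      by (simp add: q_def power_mult_distrib power2_eq_square power3_eq_cube mult_ac)
    then have "q * r ^ n \<le> K"
      using \<open>1 \<le> r\<close> by (subst (asm) mult_le_cancel_right) auto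
    moreover have "q * r \<le> q * r ^ n"
      using \<open>1 \<le> r\<close> \<open>1 \<le> n\<close> \<open>q > 0\<close> self_le_power[of r n] by (intro mult_left_mono) auto
    ultimately show ?thesis by linarith
  qed
  have "q * (K / q + 1) \<le> K"
    using \<open>K \<ge> 0\<close> \<open>q > 0\<close> by (intro bound) auto
  then show False
    using \<open>q > 0\<close> by (simp add: distrib_left)
qed

end

section \<open>Integral operators along rays\<close>

text \<open>The substitution \<open>w = t * z\<close>; the factor is the Jacobian in real dimension
  2.\<close>

lemma nn_integral_lborel_scaleR:
  fixes H :: "complex \<Rightarrow> ennreal"
  assumes [measurable]: "H \<in> borel_measurable borel" and "0 < t"
  shows "(\<integral>\<^sup>+z. H z \<partial>lborel) = (\<integral>\<^sup>+w. ennreal (1 / t\<^sup>2) * H (w /\<^sub>R t) \<partial>lborel)"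
proof -
  have "(\<integral>\<^sup>+z. H z \<partial>lborel) = (\<integral>\<^sup>+z. H z \<partial>density (distr lborel borel (\<lambda>x. 0 + inverse t *\<^sub>R x)) (\<lambda>_. \<bar>inverse t\<bar> ^ DIM(complex)))"
    using \<open>0 < t\<close> by (subst lborel_affine[of "inverse t" 0]) auto
  also have "\<dots> = (\<integral>\<^sup>+w. ennreal (1 / t\<^sup>2) * H (w /\<^sub>R t) \<partial>lborel)"
    using \<open>0 < t\<close> by (simp add: nn_integral_density nn_integral_distr power_inverse divide_inverse)
  finally show ?thesis .
qed

text \<open>Monotone limit over closed intervals, for integrands whose primitive is available only
  away from 0.\<close>

lemma nn_integral_Ioc_le:
  fixes f :: "real \<Rightarrow> ennreal"
  assumes [measurable]: "f \<in> borel_measurable borel"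
    and le: "\<And>\<epsilon>. 0 < \<epsilon> \<Longrightarrow> \<epsilon> \<le> 1 \<Longrightarrow> (\<integral>\<^sup>+t. f t * indicator {\<epsilon>..1} t \<partial>lborel) \<le> B"
  shows "(\<integral>\<^sup>+t. f t * indicator {0<..1} t \<partial>lborel) \<le> B"
proof -
  define I where "I n = {1 / real (Suc n)..1}" for n
  have UN: "{0<..1} = (\<Union>n. I n)"
  proof (intro equalityI subsetI)
    fix t :: real assume t: "t \<in> {0<..1}"
    then obtain n where "inverse (real (Suc n)) < t"
      using reals_Archimedean[of t] by auto
    then show "t \<in> (\<Union>n. I n)" using t by (auto simp: I_def divide_inverse intro!: exI[of _ n])
  qed (auto simp: I_def intro: less_le_trans[rotated])
  have "(\<integral>\<^sup>+t. f t * indicator {0<..1} t \<partial>lborel) = emeasure (density lborel f) (\<Union>n. I n)"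
    unfolding UN by (subst emeasure_density) (auto simp: I_def)
  also have "\<dots> = (SUP n. emeasure (density lborel f) (I n))"
    by (rule SUP_emeasure_incseq[symmetric])
       (auto simp: I_def incseq_def divide_inverse intro: order_trans[OF le_imp_inverse_le])
  also have "\<dots> \<le> B"
  proof (rule SUP_least)
    fix n
    have "emeasure (density lborel f) (I n) = (\<integral>\<^sup>+t. f t * indicator (I n) t \<partial>lborel)"
      by (subst emeasure_density) (auto simp: I_def)
    also have "\<dots> \<le> B" unfolding I_def by (rule le) auto
    finally show "emeasure (density lborel f) (I n) \<le> B" .
  qed
  finally show ?thesis .
qed

text \<open>This is \<open>ln y \<le> y - 1\<close> at \<open>y = a * s / q\<close>, after
  discarding the helpful term \<open>- q\<close>.\<close>

lemma powr_le_exp: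
  fixes s q a :: real
  assumes "0 < s" "0 < q" "0 < a"
  shows "s powr q \<le> (q / a) powr q * exp (a * s)"
proof -
  have "ln (a * s / q) \<le> a * s / q - 1"
    using assms by (intro ln_le_minus_one) auto
  then have "q * ln (a * s / q) \<le> a * s - q"
    using assms by (simp add: field_simps)
  then have "q * ln s \<le> q * ln (q / a) + a * s"
    using assms by (simp add: ln_mult ln_div algebra_simps)
  then show ?thesis
    using assms by (simp add: powr_def exp_add[symmetric])
qed

context fock
begin

text \<open>The exponential is the decay of weighted \<open>W\<close> along a ray with gap
  \<open>d\<close>; the powers come from \<open>norm z * (t * norm z) powr (A - 1)\<close>, the size
  of \<open>z * deriv g (t * z)\<close> up to a constant. The cut-off at \<open>R\<close> keeps to
  the region where the bound on \<open>deriv g\<close> holds.\<close>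

definition radial_kernel :: "real \<Rightarrow> real \<Rightarrow> complex \<Rightarrow> real \<Rightarrow> real" where
  "radial_kernel d R z t = (if 0 < t \<and> t \<le> 1 \<and> R \<le> t * norm z
     then exp (- d * norm z powr A * (1 - t powr A)) * norm z powr A * t powr (A - 1) else 0)"

lemma radial_kernel_nonneg: "0 \<le> radial_kernel d R z t"
  by (simp add: radial_kernel_def)

lemma radial_kernel_measurable [measurable]:
  "(\<lambda>x. radial_kernel d R (fst x) (snd x)) \<in> borel_measurable (borel \<Otimes>\<^sub>M borel)"
  unfolding radial_kernel_def by measurable

text \<open>On its support the kernel is the exact derivative in \<open>t\<close> of its exponential
  factor divided by \<open>d * A\<close>.\<close>

lemma nn_integral_radial_kernel_le:
  assumes "0 < d" "0 < R"
  shows "(\<integral>\<^sup>+t. ennreal (radial_kernel d R z t) \<partial>lborel) \<le> ennreal (1 / (d * A))"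
proof (cases "R \<le> norm z")
  case False
  then have "radial_kernel d R z t = 0" for t
    using mult_right_mono[of t 1 "norm z"] by (auto simp: radial_kernel_def)
  then show ?thesis by simp
next
  case True
  define t0 where "t0 = R / norm z"
  have z: "0 < norm z" using True assms by linarith
  then have t0: "0 < t0" "t0 \<le> 1" unfolding t0_def using True assms by (auto simp only: divide_le_eq_1_pos intro: divide_pos_pos)
  define F where "F t = 1 / (d * A) * exp (- d * norm z powr A * (1 - t powr A))" for t
  define f where "f t = exp (- d * norm z powr A * (1 - t powr A)) * norm z powr A * t powr (A - 1)" for t
  have "(\<integral>\<^sup>+t. ennreal (radial_kernel d R z t) \<partial>lborel) = (\<integral>\<^sup>+t. ennreal (f t) * indicator {t0..1} t \<partial>lborel)"
  proof (intro nn_integral_cong)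
    fix t
    have "0 < t" if "R \<le> t * norm z"
      using that \<open>0 < R\<close> z by (metis less_le_trans zero_less_mult_pos2)
    then show "ennreal (radial_kernel d R z t) = ennreal (f t) * indicator {t0..1} t"
      using z by (auto simp: radial_kernel_def f_def t0_def indicator_def field_simps)
  qed
  also have "\<dots> = ennreal (F 1 - F t0)"
  proof (rule nn_integral_FTC_Icc)
    show "f \<in> borel_measurable borel" unfolding f_def by measurable
    fix t assume "t \<in> {t0..1}"
    then have "0 < t" using t0 by simp
    then show "(F has_real_derivative f t) (at t)"
      unfolding F_def f_def using \<open>0 < d\<close> A_pos
      by (auto intro!: derivative_eq_intros simp: field_simps)
  qed (use t0 in \<open>auto simp: f_def\<close>)
  also have "\<dots> \<le> ennreal (1 / (d * A))"
    using assms A_pos by (intro ennreal_leI) (simp add: F_def)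
  finally show ?thesis .
qed

text \<open>The constant comes from \<open>t\<^bsup>A-2\<^esup> \<le> s\<^bsup>2/A\<^esup>\<close> with \<open>s = t\<^bsup>-A\<^esup>\<close>, which half of the exponential decay absorbs.\<close>

definition kernel_const :: "real \<Rightarrow> real" where
  "kernel_const d = (4 / (d * A)) powr (2 / A) * exp (d / 2) * (2 / (d * A))"

text \<open>The companion bound, with \<open>w = t * z\<close> held fixed instead of
  \<open>z\<close> and the Jacobian included.\<close>

lemma nn_integral_radial_kernel_dual_le:
  assumes "0 < d" "1 \<le> R"
  shows "(\<integral>\<^sup>+t. ennreal (1 / t\<^sup>2 * radial_kernel d R (w /\<^sub>R t) t) * indicator {0<..1} t \<partial>lborel) \<le> ennreal (kernel_const d)"
proof (cases "R \<le> norm w")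
  case False
  then have "radial_kernel d R (w /\<^sub>R t) t = 0" if "0 < t" for t
    using that by (simp add: radial_kernel_def mult.assoc[symmetric])
  then have "(\<integral>\<^sup>+t. ennreal (1 / t\<^sup>2 * radial_kernel d R (w /\<^sub>R t) t) * indicator {0<..1} t \<partial>lborel) = (\<integral>\<^sup>+(t::real). 0 \<partial>lborel)"
    by (intro nn_integral_cong) (auto simp: indicator_def)
  then show ?thesis by simp
next
  case True
  define x where "x = norm w powr A"
  have w: "1 \<le> norm w" using True assms by simp
  have x: "1 \<le> x" using w A_pos by (simp add: x_def ge_one_powr_ge_zero)
  define K where "K = (4 / (d * A)) powr (2 / A) * exp (d / 2)"
  define f where "f t = exp (- (d / 2) * x * (t powr (- A) - 1)) * x * t powr (- A - 1)" for t
  define F where "F t = 2 / (d * A) * exp (- (d / 2) * x * (t powr (- A) - 1))" for t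
  have [measurable]: "f \<in> borel_measurable borel" unfolding f_def by measurable
  have "(\<integral>\<^sup>+t. ennreal (1 / t\<^sup>2 * radial_kernel d R (w /\<^sub>R t) t) * indicator {0<..1} t \<partial>lborel)
      \<le> (\<integral>\<^sup>+t. ennreal K * ennreal (f t) * indicator {0<..1} t \<partial>lborel)"
  proof (rule nn_integral_mono)
    fix t :: real
    have "1 / t\<^sup>2 * radial_kernel d R (w /\<^sub>R t) t \<le> K * f t" if t: "0 < t" "t \<le> 1"
    proof -
      \<comment> \<open>For \<open>z = w / t\<close> the quantity \<open>norm z powr A\<close> is
        \<open>x * s\<close>, and the exponent becomes \<open>- d * x * (s - 1)\<close>.\<close>
      define s where "s = t powr (- A)"
      have s: "1 \<le> s" using t A_pos by (simp add: s_def powr_minus powr_le1 one_le_inverse)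
      have "norm (w /\<^sub>R t) powr A = x * s"
        using t w by (simp add: x_def s_def powr_mult powr_minus powr_divide divide_inverse inverse_powr)
      moreover have "s * (1 - t powr A) = s - 1"
        using t by (simp add: s_def right_diff_distrib powr_add[symmetric])
      moreover have "t * norm (w /\<^sub>R t) = norm w"
        using t by simp
      then have "radial_kernel d R (w /\<^sub>R t) t
          = exp (- d * norm (w /\<^sub>R t) powr A * (1 - t powr A)) * norm (w /\<^sub>R t) powr A * t powr (A - 1)"
        unfolding radial_kernel_def using t True by (simp del: norm_scaleR)
      ultimately have "radial_kernel d R (w /\<^sub>R t) t = exp (- d * x * (s - 1)) * (x * s) * t powr (A - 1)"
        by (simp only: mult.assoc)
      then have "1 / t\<^sup>2 * radial_kernel d R (w /\<^sub>R t) t = exp (- d * x * (s - 1)) * x * (s * (t powr (A - 1) * t powr (- 2)))"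
        using t by (simp add: powr_minus powr_numeral divide_inverse mult_ac)
      also have "s * (t powr (A - 1) * t powr (- 2)) = t powr (A - 2) * t powr (- A - 1)"
        by (simp add: s_def powr_add[symmetric])
      \<comment> \<open>Half of the decay pays for \<open>t powr (A - 2)\<close>; the other half
        stays in \<open>f\<close>, which has the explicit primitive \<open>F\<close>.\<close>
      also have "exp (- d * x * (s - 1)) * x * (t powr (A - 2) * t powr (- A - 1))
          = (exp (- (d / 2) * x * (s - 1)) * t powr (A - 2)) * f t"
        by (simp add: f_def s_def exp_add[symmetric] mult_ac) (simp add: exp_add[symmetric] algebra_simps)
      also have "\<dots> \<le> K * f t"
      proof (rule mult_right_mono)
        \<comment> \<open>Here \<open>1 \<le> R\<close> enters through \<open>1 \<le> x\<close>:
          dropping \<open>x\<close> makes the constant independent of \<open>w\<close>.\<close>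
        have "exp (- (d / 2) * x * (s - 1)) \<le> exp (- (d / 2) * (s - 1))"
          using x s \<open>0 < d\<close> mult_right_mono[of 1 x "s - 1"] by simp
        moreover have "t powr (A - 2) \<le> s powr (2 / A)"
          using t A_pos by (simp add: s_def powr_powr powr_mono')
        moreover have "s powr (2 / A) \<le> (2 / A / (d / 2)) powr (2 / A) * exp (d / 2 * s)"
          using s A_pos \<open>0 < d\<close> by (intro powr_le_exp) auto
        ultimately have "exp (- (d / 2) * x * (s - 1)) * t powr (A - 2)
            \<le> exp (- (d / 2) * (s - 1)) * ((2 / A / (d / 2)) powr (2 / A) * exp (d / 2 * s))"
          by (intro mult_mono) auto
        also have "\<dots> = (2 / A / (d / 2)) powr (2 / A) * (exp (- (d / 2) * (s - 1)) * exp (d / 2 * s))"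
          by (simp only: mult_ac)
        also have "exp (- (d / 2) * (s - 1)) * exp (d / 2 * s) = exp (d / 2)"
          unfolding exp_add[symmetric] by (simp add: field_simps)
        also have "(2 / A / (d / 2)) powr (2 / A) * exp (d / 2) = K"
          by (simp add: K_def mult.commute)
        finally show "exp (- (d / 2) * x * (s - 1)) * t powr (A - 2) \<le> K" .
      qed (use x in \<open>simp add: f_def\<close>)
      finally show ?thesis .
    qed
    then show "ennreal (1 / t\<^sup>2 * radial_kernel d R (w /\<^sub>R t) t) * indicator {0<..1} t \<le> ennreal K * ennreal (f t) * indicator {0<..1} t"
      using x by (auto simp: indicator_def K_def f_def ennreal_mult[symmetric] intro!: ennreal_leI)
  qed
  also have "\<dots> = ennreal K * (\<integral>\<^sup>+t. ennreal (f t) * indicator {0<..1} t \<partial>lborel)"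
    by (subst nn_integral_cmult[symmetric]) (auto simp: mult_ac)
  also have "\<dots> \<le> ennreal K * ennreal (2 / (d * A))"
  proof (intro mult_left_mono nn_integral_Ioc_le)
    fix \<epsilon> :: real assume \<epsilon>: "0 < \<epsilon>" "\<epsilon> \<le> 1"
    have "(\<integral>\<^sup>+t. ennreal (f t) * indicator {\<epsilon>..1} t \<partial>lborel) = ennreal (F 1 - F \<epsilon>)"
    proof (rule nn_integral_FTC_Icc)
      fix t assume "t \<in> {\<epsilon>..1}"
      then have "0 < t" using \<epsilon> by simp
      then show "(F has_real_derivative f t) (at t)"
        unfolding F_def f_def using \<open>0 < d\<close> A_pos
        by (auto intro!: derivative_eq_intros simp: field_simps)
    qed (use \<epsilon> x in \<open>auto simp: f_def\<close>)
    also have "\<dots> \<le> ennreal (2 / (d * A))"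
      using \<open>0 < d\<close> A_pos by (intro ennreal_leI) (simp add: F_def)
    finally show "(\<integral>\<^sup>+t. ennreal (f t) * indicator {\<epsilon>..1} t \<partial>lborel) \<le> ennreal (2 / (d * A))" .
  qed auto
  also have "\<dots> = ennreal (kernel_const d)"
    using \<open>0 < d\<close> A_pos by (simp add: kernel_const_def K_def ennreal_mult[symmetric])
  finally show ?thesis .
qed

text \<open>A Schur-type test: the mass in \<open>t\<close> for fixed \<open>z\<close> enters
  through Jensen's inequality, and the dual mass for fixed \<open>w\<close> through Tonelli's
  theorem and scaling.\<close>

lemma radial_kernel_bounded:
  fixes x u :: "complex \<Rightarrow> real"
  assumes "0 < d" "1 \<le> R" and [measurable]: "u \<in> borel_measurable borel"
    and u: "\<And>z. 0 \<le> u z" and x: "\<And>z. 0 \<le> x z"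
    and le: "\<And>z. ennreal (x z) \<le> (\<integral>\<^sup>+t. ennreal (radial_kernel d R z t) * ennreal (u (t *\<^sub>R z)) \<partial>lborel)"
  shows "(\<integral>\<^sup>+z. ennreal (x z powr p) \<partial>lborel)
     \<le> ennreal ((1 / (d * A)) powr (p - 1) * kernel_const d) * (\<integral>\<^sup>+z. ennreal (u z powr p) \<partial>lborel)"
proof -
  define M where "M = (1 / (d * A)) powr (p - 1)"
  define k where "k z t = ennreal (radial_kernel d R z t)" for z t
  define U where "U z = ennreal (u z powr p)" for z
  have [measurable]: "U \<in> borel_measurable borel" unfolding U_def by measurable
  have k_meas [measurable]: "(\<lambda>x. k (fst x) (snd x)) \<in> borel_measurable (borel \<Otimes>\<^sub>M borel)"
    unfolding k_def by measurable
  \<comment> \<open>Supplies measurability of \<open>k\<close> under substitutions such as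
    \<open>k (w /\<^sub>R t) t\<close>.\<close>
  have k_comp: "(\<lambda>x. k (a x) (b x)) \<in> borel_measurable N"
    if "a \<in> borel_measurable N" "b \<in> borel_measurable N" for a b and N :: "'z measure"
    using measurable_compose[OF measurable_Pair[OF that] k_meas] by simp
  have [measurable]: "k z \<in> borel_measurable borel" "(\<lambda>z. k z t) \<in> borel_measurable borel" for z t
    by (rule k_comp; measurable)+
  have pt: "ennreal (x z powr p) \<le> ennreal M * (\<integral>\<^sup>+t. k z t * U (t *\<^sub>R z) \<partial>lborel)" for z
    unfolding M_def U_def
    by (rule powr_nn_integral_le)
       (use assms le[of z] A_pos p_ge_1 nn_integral_radial_kernel_le[of d R z] in \<open>auto simp: k_def[symmetric]\<close>)
  have "(\<integral>\<^sup>+z. ennreal (x z powr p) \<partial>lborel) \<le> (\<integral>\<^sup>+z. ennreal M * (\<integral>\<^sup>+t. k z t * U (t *\<^sub>R z) \<partial>lborel) \<partial>lborel)"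
    by (intro nn_integral_mono pt)
  also have "\<dots> = ennreal M * (\<integral>\<^sup>+z. \<integral>\<^sup>+t. k z t * U (t *\<^sub>R z) \<partial>lborel \<partial>lborel)"
    by (intro nn_integral_cmult lborel.borel_measurable_nn_integral borel_measurable_times k_comp) (auto simp: case_prod_beta')
  also have "(\<integral>\<^sup>+z. \<integral>\<^sup>+t. k z t * U (t *\<^sub>R z) \<partial>lborel \<partial>lborel) = (\<integral>\<^sup>+t. \<integral>\<^sup>+z. k z t * U (t *\<^sub>R z) \<partial>lborel \<partial>lborel)"
    by (intro lborel_pair.Fubini'[symmetric]) (auto simp: case_prod_beta' intro!: borel_measurable_times k_comp)
  \<comment> \<open>The kernel vanishes outside \<open>{0<..1}\<close>; the explicit indicator
    confines the substitution to \<open>t > 0\<close>.\<close>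
  also have "\<dots> = (\<integral>\<^sup>+t. \<integral>\<^sup>+w. ennreal (1 / t\<^sup>2) * k (w /\<^sub>R t) t * indicator {0<..1} t * U w \<partial>lborel \<partial>lborel)"
  proof (rule nn_integral_cong)
    fix t :: real
    show "(\<integral>\<^sup>+z. k z t * U (t *\<^sub>R z) \<partial>lborel) = (\<integral>\<^sup>+w. ennreal (1 / t\<^sup>2) * k (w /\<^sub>R t) t * indicator {0<..1} t * U w \<partial>lborel)"
    proof (cases "0 < t \<and> t \<le> 1")
      case True
      then show ?thesis
        by (subst nn_integral_lborel_scaleR[of _ t]) (auto simp: mult_ac)
    qed (auto simp: k_def radial_kernel_def)
  qed
  also have "\<dots> = (\<integral>\<^sup>+w. \<integral>\<^sup>+t. ennreal (1 / t\<^sup>2) * k (w /\<^sub>R t) t * indicator {0<..1} t * U w \<partial>lborel \<partial>lborel)"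
  proof (intro lborel_pair.Fubini'[symmetric])
    have [measurable]: "(\<lambda>x. k (snd x /\<^sub>R fst x) (fst x)) \<in> borel_measurable (lborel \<Otimes>\<^sub>M lborel)"
      by (rule k_comp) measurable
    show "(\<lambda>(t, w). ennreal (1 / t\<^sup>2) * k (w /\<^sub>R t) t * indicator {0<..1} t * U w) \<in> borel_measurable (lborel \<Otimes>\<^sub>M lborel)"
      unfolding case_prod_beta' by measurable
  qed
  also have "\<dots> \<le> (\<integral>\<^sup>+w. ennreal (kernel_const d) * U w \<partial>lborel)"
  proof (rule nn_integral_mono)
    fix w
    have "(\<lambda>t. k (w /\<^sub>R t) t) \<in> borel_measurable borel"
      by (rule k_comp) measurable
    note [measurable] = this
    have "(\<integral>\<^sup>+t. ennreal (1 / t\<^sup>2) * k (w /\<^sub>R t) t * indicator {0<..1} t * U w \<partial>lborel)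
        = (\<integral>\<^sup>+t. ennreal (1 / t\<^sup>2) * k (w /\<^sub>R t) t * indicator {0<..1} t \<partial>lborel) * U w"
      by (rule nn_integral_multc) measurable
    also have "\<dots> \<le> ennreal (kernel_const d) * U w"
      using nn_integral_radial_kernel_dual_le[OF \<open>0 < d\<close> \<open>1 \<le> R\<close>, of w]
      by (intro mult_right_mono) (simp_all add: k_def ennreal_mult[symmetric] radial_kernel_nonneg)
    finally show "(\<integral>\<^sup>+t. ennreal (1 / t\<^sup>2) * k (w /\<^sub>R t) t * indicator {0<..1} t * U w \<partial>lborel) \<le> \<dots>" .
  qed
  also have "\<dots> = ennreal (kernel_const d) * (\<integral>\<^sup>+w. U w \<partial>lborel)"
    by (rule nn_integral_cmult) measurable
  finally show ?thesis
    using \<open>0 < d\<close> A_pos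
    by (simp add: M_def U_def mult.assoc[symmetric] ennreal_mult[symmetric] kernel_const_def mult_left_mono)
qed

end

section \<open>The resolvent outside the disc\<close>

context volterra_fock
begin

definition Q :: "complex \<Rightarrow> (complex \<Rightarrow> complex) \<Rightarrow> complex \<Rightarrow> complex" where
  "Q \<mu> h z = contour_integral (linepath 0 z) (\<lambda>\<zeta>. h \<zeta> * deriv g \<zeta> / W \<mu> \<zeta>)"

text \<open>Variation of constants: with \<open>y = T f\<close> the equation
  \<open>\<mu> * f - T f = h\<close> becomes \<open>y' = (h + y) * g' / \<mu>\<close>, whose
  solution with \<open>y 0 = 0\<close> is \<open>y = W * Q / \<mu>\<close>; then
  \<open>f = (h + y) / \<mu>\<close>.\<close>

definition resolvent :: "complex \<Rightarrow> (complex \<Rightarrow> complex) \<Rightarrow> complex \<Rightarrow> complex" where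
  "resolvent \<mu> h z = h z / \<mu> + W \<mu> z * Q \<mu> h z / \<mu>\<^sup>2"

lemma W_nonzero [simp]: "W \<mu> z \<noteq> 0"
  by (simp add: W_def)

lemma Q_0 [simp]: "Q \<mu> h 0 = 0"
  by (simp add: Q_def)

lemma Q_integrand_hol: "h holomorphic_on UNIV \<Longrightarrow> (\<lambda>\<zeta>. h \<zeta> * deriv g \<zeta> / W \<mu> \<zeta>) holomorphic_on UNIV"
  by (intro holomorphic_intros W_hol g_hol) auto

lemma has_field_derivative_Q:
  "h holomorphic_on UNIV \<Longrightarrow> (Q \<mu> h has_field_derivative h z * deriv g z / W \<mu> z) (at z)"
  using has_field_derivative_contour_integral_linepath[OF Q_integrand_hol, of h 0 \<mu> z]
  by (simp add: Q_def[abs_def])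

lemma Q_hol: "h holomorphic_on UNIV \<Longrightarrow> Q \<mu> h holomorphic_on UNIV"
  by (rule holomorphic_onI) (meson has_field_derivative_Q field_differentiable_at_within field_differentiable_def)

lemma resolvent_hol: "h holomorphic_on UNIV \<Longrightarrow> resolvent \<mu> h holomorphic_on UNIV"
  unfolding resolvent_def[abs_def] divide_inverse by (intro holomorphic_intros W_hol Q_hol)

lemma resolvent_right:
  assumes h: "h holomorphic_on UNIV" and "\<mu> \<noteq> 0"
  shows "(\<lambda>z. \<mu> * resolvent \<mu> h z - T (resolvent \<mu> h) z) = h"
proof -
  have "T (resolvent \<mu> h) = (\<lambda>z. W \<mu> z * Q \<mu> h z / \<mu>)"
  proof (rule volterra_eqI)
    fix z
    have "((\<lambda>z. W \<mu> z * Q \<mu> h z / \<mu>) has_field_derivative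
        (W \<mu> z * (h z * deriv g z / W \<mu> z) + W \<mu> z * deriv g z / \<mu> * Q \<mu> h z) / \<mu>) (at z)"
      by (intro DERIV_cdivide DERIV_mult' has_field_derivative_W has_field_derivative_Q h)
    also have "(W \<mu> z * (h z * deriv g z / W \<mu> z) + W \<mu> z * deriv g z / \<mu> * Q \<mu> h z) / \<mu> = resolvent \<mu> h z * deriv g z"
      using \<open>\<mu> \<noteq> 0\<close> by (simp add: resolvent_def field_simps power2_eq_square)
    finally show "((\<lambda>z. W \<mu> z * Q \<mu> h z / \<mu>) has_field_derivative resolvent \<mu> h z * deriv g z) (at z)" .
  qed simp
  then show ?thesis
    using \<open>\<mu> \<noteq> 0\<close> by (simp add: resolvent_def fun_eq_iff field_simps power2_eq_square)
qed

text \<open>By \<open>resolvent_right\<close> both sides solve the same equation, and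
  \<open>\<mu> - T\<close> is injective on entire functions.\<close>

lemma resolvent_left:
  assumes f: "f holomorphic_on UNIV" and "\<mu> \<noteq> 0"
  shows "resolvent \<mu> (\<lambda>z. \<mu> * f z - T f z) = f"
proof -
  have Tf: "T f holomorphic_on UNIV"
    by (rule holomorphic_onI) (meson has_field_derivative_volterra[OF f g_hol] field_differentiable_at_within field_differentiable_def)
  define h where "h = (\<lambda>z. \<mu> * f z - T f z)"
  have h: "h holomorphic_on UNIV" unfolding h_def by (intro holomorphic_intros f Tf)
  have "resolvent \<mu> h z - f z = 0" for z
  proof (rule volterra_eigen_zero[OF _ g_hol \<open>\<mu> \<noteq> 0\<close>, where f = "\<lambda>z. resolvent \<mu> h z - f z"])
    show "(\<lambda>z. resolvent \<mu> h z - f z) holomorphic_on UNIV" by (intro holomorphic_intros resolvent_hol h f)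
    fix z show "\<mu> * (resolvent \<mu> h z - f z) = T (\<lambda>z. resolvent \<mu> h z - f z) z"
      using fun_cong[OF resolvent_right[OF h \<open>\<mu> \<noteq> 0\<close>], of z]
      unfolding volterra_diff[OF resolvent_hol[OF h] f] by (simp add: h_def algebra_simps)
  qed
  then show ?thesis by (simp add: fun_eq_iff h_def)
qed

lemma resolvent_linear:
  assumes f: "f holomorphic_on UNIV" and h: "h holomorphic_on UNIV"
  shows "resolvent \<mu> (\<lambda>z. a * f z + b * h z) = (\<lambda>z. a * resolvent \<mu> f z + b * resolvent \<mu> h z)"
proof -
  have "Q \<mu> (\<lambda>z. a * f z + b * h z) = (\<lambda>z. a * Q \<mu> f z + b * Q \<mu> h z)"
  proof (rule eq_if_has_field_derivative_eq[where a = 0])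
    fix z
    show "(Q \<mu> (\<lambda>z. a * f z + b * h z) has_field_derivative (a * f z + b * h z) * deriv g z / W \<mu> z) (at z)"
      by (intro has_field_derivative_Q holomorphic_intros f h)
    have "((\<lambda>z. a * Q \<mu> f z + b * Q \<mu> h z) has_field_derivative a * (f z * deriv g z / W \<mu> z) + b * (h z * deriv g z / W \<mu> z)) (at z)"
      by (intro DERIV_add DERIV_cmult has_field_derivative_Q f h)
    then show "((\<lambda>z. a * Q \<mu> f z + b * Q \<mu> h z) has_field_derivative (a * f z + b * h z) * deriv g z / W \<mu> z) (at z)"
      by (simp add: algebra_simps add_divide_distrib)
  qed simp
  then show ?thesis
    by (simp add: resolvent_def fun_eq_iff add_divide_distrib algebra_simps)
qed

text \<open>The inverse identities and linearity hold on all entire functions, so boundedness is the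
  only issue left.\<close>

lemma not_in_spectrum_if_resolvent_bounded:
  assumes "\<mu> \<noteq> 0" and bound: "\<And>h. h \<in> V \<Longrightarrow> mass (resolvent \<mu> h) \<le> ennreal K * mass h" and "0 \<le> K"
  shows "\<mu> \<notin> operator_spectrum V N T"
proof -
  have *: "resolvent \<mu> h \<in> V" "N (resolvent \<mu> h) \<le> K powr (1 / p) * N h" if h: "h \<in> V" for h
  proof -
    have "mass (resolvent \<mu> h) \<le> ennreal ((K powr (1 / p) * N h) powr p)"
      using bound[OF h] \<open>0 \<le> K\<close> p_ge_1
      by (simp add: mass_eq[OF h] powr_mult fock_norm_nonneg powr_powr ennreal_mult)
    then show "resolvent \<mu> h \<in> V" "N (resolvent \<mu> h) \<le> K powr (1 / p) * N h"
      using fock_space_normI[OF resolvent_hol[OF holomorphic_fock[OF h]], of "K powr (1 / p) * N h"]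
      by (auto simp: fock_norm_nonneg)
  qed
  have "bounded_operator_on V N (resolvent \<mu>)"
    unfolding bounded_operator_on_def using * by (auto intro: resolvent_linear holomorphic_fock)
  then show ?thesis
    unfolding operator_spectrum_def
    using resolvent_left[OF holomorphic_fock \<open>\<mu> \<noteq> 0\<close>] resolvent_right[OF holomorphic_fock \<open>\<mu> \<noteq> 0\<close>] by auto
qed

section \<open>Decay along rays and boundedness of the resolvent\<close>

definition \<psi> :: "complex \<Rightarrow> complex \<Rightarrow> real" where
  "\<psi> \<mu> z = norm (W \<mu> z) * exp (- \<alpha> * norm z powr A)"

lemma \<psi>_nonneg: "0 \<le> \<psi> \<mu> z"
  by (simp add: \<psi>_def)

text \<open>The segment from \<open>s * z\<close> to \<open>z\<close> stays where the bound on
  \<open>deriv g\<close> holds. Integrating that bound limits the change of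
  \<open>Re (G / \<mu>)\<close> to \<open>\<kappa> * norm z powr A * (1 - s powr A)\<close>, while
  the weight contributes the same expression with \<open>- \<alpha>\<close> for
  \<open>\<kappa>\<close>.\<close>

lemma \<psi>_ray_decay:
  assumes "\<mu> \<noteq> 0" and dg: "\<And>z. R \<le> norm z \<Longrightarrow> norm (deriv g z) \<le> norm \<mu> * \<kappa> * A * norm z powr (A - 1)"
    and s: "0 < s" "s \<le> 1" "R \<le> s * norm z" and "0 < R"
  shows "\<psi> \<mu> z \<le> exp (- (\<alpha> - \<kappa>) * norm z powr A * (1 - s powr A)) * \<psi> \<mu> (s *\<^sub>R z)"
proof -
  have z: "0 < norm z"
    using s \<open>0 < R\<close> by (metis less_le_trans zero_less_mult_pos)
  have G': "((\<lambda>t. G (t *\<^sub>R z)) has_vector_derivative z * deriv g (t *\<^sub>R z)) (at t)" for t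
  proof -
    have "((\<lambda>t. t *\<^sub>R z) has_vector_derivative z) (at t)"
      by (auto intro!: derivative_eq_intros simp: has_vector_derivative_def)
    from field_vector_diff_chain_at[OF this has_field_derivative_G] show ?thesis
      by (simp add: o_def)
  qed
  \<comment> \<open>The redundant factors 1 give the claim the shape of the mean value inequality on
    \<open>{s..1}\<close>; the degenerate case \<open>s = 1\<close> is trivial.\<close>
  have "norm (G (1 *\<^sub>R z) - G (s *\<^sub>R z)) \<le> norm \<mu> * \<kappa> * (1 * norm z) powr A - norm \<mu> * \<kappa> * (s * norm z) powr A"
  proof (cases "s = 1")
    case False
    show ?thesis
    proof (rule differentiable_bound_general)
      show "s < 1" using s False by simp
      show "continuous_on {s..1} (\<lambda>t. G (t *\<^sub>R z))"
        using G' by (intro continuous_at_imp_continuous_on ballI has_vector_derivative_continuous) auto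
      show "continuous_on {s..1} (\<lambda>t. norm \<mu> * \<kappa> * (t * norm z) powr A)"
        using s z by (intro continuous_intros) auto
      fix t assume t: "s < t" "t < 1"
      show "((\<lambda>t. G (t *\<^sub>R z)) has_vector_derivative z * deriv g (t *\<^sub>R z)) (at t)"
        by (rule G')
      have "0 < t" using s t by simp
      then show "((\<lambda>t. norm \<mu> * \<kappa> * (t * norm z) powr A) has_vector_derivative
          norm \<mu> * \<kappa> * A * (t * norm z) powr (A - 1) * norm z) (at t)"
        using z unfolding has_real_derivative_iff_has_vector_derivative[symmetric]
        by (auto intro!: derivative_eq_intros simp: powr_diff field_simps)
      have "s * norm z \<le> t * norm z"
        using t z by (intro mult_right_mono) auto
      then have "R \<le> norm (t *\<^sub>R z)" using s \<open>0 < t\<close> by simp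
      from mult_right_mono[OF dg[OF this], of "norm z"]
      show "norm (z * deriv g (t *\<^sub>R z)) \<le> norm \<mu> * \<kappa> * A * (t * norm z) powr (A - 1) * norm z"
        using \<open>0 < t\<close> by (simp add: norm_mult mult.commute[of "norm z"])
    qed
  qed simp
  then have "norm (G z - G (s *\<^sub>R z)) \<le> norm \<mu> * (\<kappa> * (norm z powr A * (1 - s powr A)))"
    using s by (simp add: powr_mult algebra_simps)
  then have "norm ((G z - G (s *\<^sub>R z)) / \<mu>) \<le> \<kappa> * (norm z powr A * (1 - s powr A))"
    using \<open>\<mu> \<noteq> 0\<close> by (simp add: norm_divide field_simps)
  then have "Re ((G z - G (s *\<^sub>R z)) / \<mu>) \<le> \<kappa> * (norm z powr A * (1 - s powr A))"
    using complex_Re_le_cmod order_trans by blast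
  then have "Re (G z / \<mu>) - \<alpha> * norm z powr A
      \<le> - (\<alpha> - \<kappa>) * norm z powr A * (1 - s powr A) + (Re (G (s *\<^sub>R z) / \<mu>) - \<alpha> * norm (s *\<^sub>R z) powr A)"
    using s by (simp add: diff_divide_distrib powr_mult algebra_simps)
  then show ?thesis
    by (simp add: \<psi>_def W_def exp_add[symmetric])
qed

lemma continuous_on_\<psi>: "continuous_on S (\<psi> \<mu>)"
  unfolding \<psi>_def[abs_def]
  by (intro continuous_intros holomorphic_on_imp_continuous_on W_hol)

text \<open>Compactness on the disc of radius \<open>R\<close>; beyond it, ray decay from the circle
  of radius \<open>R\<close>, where the two exponents add up to the one claimed.\<close>

lemma \<psi>_le_exp:
  assumes "\<mu> \<noteq> 0" and dg: "\<And>z. R \<le> norm z \<Longrightarrow> norm (deriv g z) \<le> norm \<mu> * \<kappa> * A * norm z powr (A - 1)"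
    and "0 < R"
  shows "\<exists>C\<ge>0. \<forall>z. \<psi> \<mu> z \<le> C * exp (- (\<alpha> - \<kappa>) * norm z powr A)"
proof -
  define d where "d = \<alpha> - \<kappa>"
  have "continuous_on (cball 0 R) (\<lambda>w. \<psi> \<mu> w * exp (d * norm w powr A))"
    by (intro continuous_intros continuous_on_\<psi>)
  then have "bounded ((\<lambda>w. \<psi> \<mu> w * exp (d * norm w powr A)) ` cball 0 R)"
    by (intro compact_imp_bounded compact_continuous_image) auto
  then obtain C where "\<And>w. w \<in> cball 0 R \<Longrightarrow> norm (\<psi> \<mu> w * exp (d * norm w powr A)) \<le> C"
    unfolding bounded_iff by blast
  then have C: "\<psi> \<mu> w * exp (d * norm w powr A) \<le> C" if "norm w \<le> R" for w
    using that by (metis \<psi>_nonneg abs_of_nonneg exp_ge_zero mem_cball_0 mult_nonneg_nonneg real_norm_def)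
  have "0 \<le> C"
    using C[of 0] \<psi>_nonneg[of \<mu> 0] \<open>0 < R\<close> by (simp add: mult_nonneg_nonneg order_trans[rotated])
  have le: "\<psi> \<mu> w \<le> C * exp (- d * norm w powr A)" if "norm w \<le> R" for w
    using C[OF that] by (simp add: exp_minus field_simps)
  have "\<psi> \<mu> z \<le> C * exp (- d * norm z powr A)" for z
  proof (cases "norm z \<le> R")
    case False
    define s where "s = R / norm z"
    have s: "0 < s" "s \<le> 1" "s * norm z = R"
    proof -
      have "0 < norm z" using False \<open>0 < R\<close> by linarith
      then show "0 < s" "s \<le> 1" "s * norm z = R"
        using False \<open>0 < R\<close> by (auto simp: s_def divide_le_eq_1_pos)
    qed
    have "\<psi> \<mu> z \<le> exp (- d * norm z powr A * (1 - s powr A)) * \<psi> \<mu> (s *\<^sub>R z)"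
      unfolding d_def using s by (intro \<psi>_ray_decay[OF \<open>\<mu> \<noteq> 0\<close> dg _ _ _ \<open>0 < R\<close>]) auto
    also have "\<dots> \<le> exp (- d * norm z powr A * (1 - s powr A)) * (C * exp (- d * norm (s *\<^sub>R z) powr A))"
      using s by (intro mult_left_mono le) auto
    also have "\<dots> = C * exp (- d * norm z powr A)"
    proof -
      have "norm (s *\<^sub>R z) powr A = norm z powr A * s powr A"
        using s(1) by (simp add: powr_mult)
      then show ?thesis
        by (simp add: exp_add[symmetric] algebra_simps del: norm_scaleR)
    qed
    finally show ?thesis .
  qed (rule le)
  then show ?thesis using \<open>0 \<le> C\<close> by (auto simp: d_def)
qed

text \<open>The segment from 0 to \<open>z\<close> is split at modulus \<open>R\<close>. The inner
  part of the integral is bounded by a multiple of \<open>N h\<close> and inherits the decay of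
  \<open>\<psi>\<close>; the outer part is dominated by the radial kernel.\<close>

lemma \<psi>_Q_le:
  assumes "\<mu> \<noteq> 0" "0 \<le> \<kappa>" and dg: "\<And>z. R \<le> norm z \<Longrightarrow> norm (deriv g z) \<le> norm \<mu> * \<kappa> * A * norm z powr (A - 1)"
    and "0 < R"
  shows "\<exists>C\<ge>0. \<forall>h\<in>V. \<forall>z. ennreal (\<psi> \<mu> z * norm (Q \<mu> h z)) \<le> ennreal (C * N h * exp (- (\<alpha> - \<kappa>) * norm z powr A))
     + (\<integral>\<^sup>+t. ennreal (radial_kernel (\<alpha> - \<kappa>) R z t)
          * ennreal (norm \<mu> * \<kappa> * A * (norm (h (t *\<^sub>R z)) * exp (- \<alpha> * norm (t *\<^sub>R z) powr A))) \<partial>lborel)"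
proof -
  define d where "d = \<alpha> - \<kappa>"
  define L where "L = norm \<mu> * \<kappa> * A"
  have "0 \<le> L" using \<open>0 \<le> \<kappa>\<close> A_pos by (simp add: L_def)
  obtain C2 where C2: "0 \<le> C2" "\<And>z. \<psi> \<mu> z \<le> C2 * exp (- d * norm z powr A)"
    using \<psi>_le_exp[OF \<open>\<mu> \<noteq> 0\<close> dg \<open>0 < R\<close>] unfolding d_def by blast
  have dg_hol: "deriv g holomorphic_on S" for S
    using holomorphic_deriv[OF g_hol] holomorphic_on_subset by blast
  have "continuous_on (cball 0 R) (\<lambda>w. deriv g w / W \<mu> w)"
    by (intro holomorphic_on_imp_continuous_on holomorphic_intros dg_hol W_hol) auto
  then have "bounded ((\<lambda>w. deriv g w / W \<mu> w) ` cball 0 R)"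
    by (intro compact_imp_bounded compact_continuous_image) auto
  then obtain C1 where "\<And>w. w \<in> cball 0 R \<Longrightarrow> norm (deriv g w / W \<mu> w) \<le> C1"
    unfolding bounded_iff by blast
  then have C1: "norm (deriv g w / W \<mu> w) \<le> C1" if "norm w \<le> R" for w
    using that by simp
  have "0 \<le> C1"
    by (rule order_trans[OF norm_ge_zero C1[of 0]]) (use \<open>0 < R\<close> in simp)
  define M where "M = 16 * exp (\<alpha> * (R + 4) powr A)"
  have "0 \<le> M" by (simp add: M_def)
  define C where "C = C2 * M * C1 * R"
  have "0 \<le> C" using \<open>0 \<le> C1\<close> C2 \<open>0 \<le> M\<close> \<open>0 < R\<close> by (simp add: C_def)
  have "ennreal (\<psi> \<mu> z * norm (Q \<mu> h z)) \<le> ennreal (C * N h * exp (- d * norm z powr A))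
     + (\<integral>\<^sup>+t. ennreal (radial_kernel d R z t) * ennreal (L * (norm (h (t *\<^sub>R z)) * exp (- \<alpha> * norm (t *\<^sub>R z) powr A))) \<partial>lborel)"
    if h: "h \<in> V" for h z
  proof (cases "z = 0")
    case False
    define u where "u w = L * (norm (h w) * exp (- \<alpha> * norm w powr A))" for w
    have u_nonneg: "0 \<le> u w" for w using \<open>0 \<le> L\<close> by (simp add: u_def)
    note h_hol = holomorphic_fock[OF h]
    note [measurable] = borel_measurable_entire[OF h_hol]
    define q where "q w = h w * deriv g w / W \<mu> w" for w
    have q_cont: "continuous_on UNIV q"
      unfolding q_def[abs_def] by (rule holomorphic_on_imp_continuous_on[OF Q_integrand_hol[OF h_hol]])
    define P where "P = \<psi> \<mu> z * (M * N h) * C1 * norm z"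
    have "0 \<le> P" using \<open>0 \<le> M\<close> \<open>0 \<le> C1\<close> by (simp add: P_def \<psi>_nonneg fock_norm_nonneg)
    define r where "r = R / norm z"
    have "0 \<le> r" using \<open>0 < R\<close> by (simp add: r_def)
    have h_le: "norm (h w) \<le> M * N h" if "norm w \<le> R" for w
    proof -
      have "norm (h w) \<le> 16 / 1\<^sup>2 * exp (\<alpha> * (norm w + 4 * 1) powr A) * N h"
        by (rule fock_pointwise_bound[OF h]) auto
      also have "\<dots> \<le> M * N h"
      proof -
        have "\<alpha> * (norm w + 4) powr A \<le> \<alpha> * (R + 4) powr A"
          using that \<alpha>_pos A_pos by (intro mult_left_mono powr_mono2) auto
        then show ?thesis
          using fock_norm_nonneg[of h] by (simp add: M_def mult_right_mono)
      qed
      finally show ?thesis .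
    qed
    have "Q \<mu> h z = z * integral {0..1} (\<lambda>t. q (t *\<^sub>R z))"
      unfolding integral_mult_right[symmetric] by (simp add: Q_def q_def contour_integral_integral linepath_def mult_ac)
    then have "ennreal (\<psi> \<mu> z * norm (Q \<mu> h z)) = ennreal (\<psi> \<mu> z * norm z) * ennreal (norm (integral {0..1} (\<lambda>t. q (t *\<^sub>R z))))"
      by (simp add: norm_mult ennreal_mult[symmetric] \<psi>_nonneg mult.assoc)
    also have "\<dots> \<le> ennreal (\<psi> \<mu> z * norm z) * (\<integral>\<^sup>+t. ennreal (norm (q (t *\<^sub>R z))) * indicator {0..1} t \<partial>lborel)"
      by (intro mult_left_mono norm_integral_le_nn_integral continuous_on_compose2[OF q_cont] continuous_intros) auto
    also have "\<dots> = (\<integral>\<^sup>+t. ennreal (\<psi> \<mu> z * norm z) * (ennreal (norm (q (t *\<^sub>R z))) * indicator {0..1} t) \<partial>lborel)"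
    proof (rule nn_integral_cmult[symmetric])
      have [measurable]: "q \<in> borel_measurable borel" by (rule borel_measurable_continuous_onI[OF q_cont])
      show "(\<lambda>t. ennreal (norm (q (t *\<^sub>R z))) * indicator {0..1} t) \<in> borel_measurable lborel" by measurable
    qed
    also have "\<dots> \<le> (\<integral>\<^sup>+t. ennreal P * indicator {0..r} t + ennreal (radial_kernel d R z t) * ennreal (u (t *\<^sub>R z)) \<partial>lborel)"
    proof (rule nn_integral_mono)
      fix t
      have small: "\<psi> \<mu> z * norm z * norm (q (t *\<^sub>R z)) \<le> P" if "0 \<le> t" "t * norm z \<le> R"
      proof -
        have "norm (t *\<^sub>R z) \<le> R" using that by simp
        then have "norm (h (t *\<^sub>R z)) * norm (deriv g (t *\<^sub>R z) / W \<mu> (t *\<^sub>R z)) \<le> (M * N h) * C1"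
          using \<open>0 \<le> M\<close> fock_norm_nonneg[of h] by (intro mult_mono h_le C1) auto
        then have "norm (q (t *\<^sub>R z)) \<le> M * N h * C1"
          by (simp add: q_def norm_mult norm_divide)
        then have "\<psi> \<mu> z * norm z * norm (q (t *\<^sub>R z)) \<le> \<psi> \<mu> z * norm z * (M * N h * C1)"
          by (intro mult_left_mono) (auto simp: \<psi>_nonneg)
        then show ?thesis by (simp add: P_def mult_ac)
      qed
      have large: "\<psi> \<mu> z * norm z * norm (q (t *\<^sub>R z)) \<le> radial_kernel d R z t * u (t *\<^sub>R z)"
        if t: "0 < t" "t \<le> 1" "R \<le> t * norm z"
      proof -
        define w where "w = t *\<^sub>R z"
        have nw: "norm w = t * norm z" using t by (simp add: w_def)
        have "\<psi> \<mu> z * norm z * norm (q w) = \<psi> \<mu> z * (norm (h w) * norm (deriv g w) / norm (W \<mu> w) * norm z)"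
          by (simp add: q_def norm_mult norm_divide)
        \<comment> \<open>The division by \<open>norm (W \<mu> w)\<close> cancels against the same
          factor in \<open>\<psi> \<mu> w\<close>, leaving the weighted modulus of \<open>h\<close>
          at \<open>w\<close>.\<close>
        also have "\<dots> \<le> (exp (- d * norm z powr A * (1 - t powr A)) * \<psi> \<mu> w)
            * (norm (h w) * (L * (t * norm z) powr (A - 1)) / norm (W \<mu> w) * norm z)"
        proof (rule mult_mono)
          show "\<psi> \<mu> z \<le> exp (- d * norm z powr A * (1 - t powr A)) * \<psi> \<mu> w"
            unfolding d_def w_def by (rule \<psi>_ray_decay[OF \<open>\<mu> \<noteq> 0\<close> dg t \<open>0 < R\<close>])
          have "norm (deriv g w) \<le> L * (t * norm z) powr (A - 1)"
            using dg[of w] t by (simp add: nw L_def)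
          then show "norm (h w) * norm (deriv g w) / norm (W \<mu> w) * norm z
              \<le> norm (h w) * (L * (t * norm z) powr (A - 1)) / norm (W \<mu> w) * norm z"
            by (intro mult_right_mono divide_right_mono mult_left_mono) auto
        qed (auto simp: \<psi>_nonneg)
        also have "\<dots> = radial_kernel d R z t * u w"
        proof -
          have "(t * norm z) powr (A - 1) * norm z = norm z powr A * t powr (A - 1)"
            using t \<open>z \<noteq> 0\<close> by (simp add: powr_mult powr_diff)
          moreover have "E * (nW * Ew) * (nh * (L * X) / nW * nz) = E * (L * (nh * Ew)) * (X * nz)"
            if "nW \<noteq> 0" for E nW Ew nh X nz :: real
            using that by (simp add: field_simps)
          ultimately show ?thesis
            using t by (simp add: radial_kernel_def u_def \<psi>_def mult_ac)
        qed
        finally show ?thesis by (simp add: w_def)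
      qed
      show "ennreal (\<psi> \<mu> z * norm z) * (ennreal (norm (q (t *\<^sub>R z))) * indicator {0..1} t)
          \<le> ennreal P * indicator {0..r} t + ennreal (radial_kernel d R z t) * ennreal (u (t *\<^sub>R z))"
      proof (cases "t \<in> {0..1}")
        case True
        have lhs: "ennreal (\<psi> \<mu> z * norm z) * (ennreal (norm (q (t *\<^sub>R z))) * indicator {0..1} t)
            = ennreal (\<psi> \<mu> z * norm z * norm (q (t *\<^sub>R z)))"
          using True by (simp add: ennreal_mult[symmetric] \<psi>_nonneg)
        show ?thesis
        proof (cases "t * norm z \<le> R")
          case True
          then have "t \<in> {0..r}"
            using \<open>t \<in> {0..1}\<close> \<open>z \<noteq> 0\<close> by (simp add: r_def field_simps)
          moreover have "ennreal (\<psi> \<mu> z * norm z * norm (q (t *\<^sub>R z))) \<le> ennreal P"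
            using \<open>t \<in> {0..1}\<close> True by (intro ennreal_leI small) auto
          ultimately show ?thesis
            unfolding lhs by (simp add: add_increasing2)
        next
          case False
          then have "0 < t" using \<open>t \<in> {0..1}\<close> \<open>0 < R\<close> by (cases "t = 0") auto
          then have "ennreal (\<psi> \<mu> z * norm z * norm (q (t *\<^sub>R z))) \<le> ennreal (radial_kernel d R z t * u (t *\<^sub>R z))"
            using False \<open>t \<in> {0..1}\<close> by (intro ennreal_leI large) auto
          also have "\<dots> = ennreal (radial_kernel d R z t) * ennreal (u (t *\<^sub>R z))"
            by (rule ennreal_mult) (auto simp: radial_kernel_nonneg u_nonneg)
          finally show ?thesis
            unfolding lhs by (simp add: add_increasing)
        qed
      qed simp
    qed
    also have "\<dots> = ennreal P * emeasure lborel {0..r} + (\<integral>\<^sup>+t. ennreal (radial_kernel d R z t) * ennreal (u (t *\<^sub>R z)) \<partial>lborel)"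
    proof -
      have [measurable]: "radial_kernel d R z \<in> borel_measurable borel"
        unfolding radial_kernel_def[abs_def] by measurable
      have [measurable]: "u \<in> borel_measurable borel" unfolding u_def by measurable
      show ?thesis
        by (subst nn_integral_add) (auto simp: nn_integral_cmult_indicator)
    qed
    \<comment> \<open>The inner interval has length \<open>R / norm z\<close>, which cancels the
      factor \<open>norm z\<close> in \<open>P\<close>.\<close>
    also have "ennreal P * emeasure lborel {0..r} \<le> ennreal (C * N h * exp (- d * norm z powr A))"
    proof -
      have "ennreal P * emeasure lborel {0..r} = ennreal (P * r)"
        using \<open>0 \<le> r\<close> \<open>0 \<le> P\<close> by (simp add: ennreal_mult)
      also have "P * r = \<psi> \<mu> z * (M * N h * C1 * R)"
        using False by (simp add: P_def r_def)
      also have "\<dots> \<le> C2 * exp (- d * norm z powr A) * (M * N h * C1 * R)"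
        using C2(2)[of z] \<open>0 \<le> M\<close> \<open>0 \<le> C1\<close> \<open>0 < R\<close> fock_norm_nonneg[of h] by (intro mult_right_mono) auto
      also have "\<dots> = C * N h * exp (- d * norm z powr A)"
        by (simp add: C_def mult_ac)
      finally show ?thesis by (simp add: ennreal_leI)
    qed
    finally show ?thesis
      by (simp add: u_def add_mono)
  qed simp
  then show ?thesis
    using \<open>0 \<le> C\<close> unfolding d_def L_def by blast
qed

text \<open>The inner part of \<open>W * Q\<close> is p-integrable because of its exponential decay,
  the outer part is handled by \<open>radial_kernel_bounded\<close>, and \<open>h / \<mu>\<close> is
  harmless.\<close>

lemma resolvent_mass_le:
  assumes "\<mu> \<noteq> 0" "0 \<le> \<kappa>" "\<kappa> < \<alpha>" "1 \<le> R"
    and dg: "\<And>z. R \<le> norm z \<Longrightarrow> norm (deriv g z) \<le> norm \<mu> * \<kappa> * A * norm z powr (A - 1)"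
  shows "\<exists>K\<ge>0. \<forall>h\<in>V. mass (resolvent \<mu> h) \<le> ennreal K * mass h"
proof -
  define d where "d = \<alpha> - \<kappa>"
  define L where "L = norm \<mu> * \<kappa> * A"
  have "0 < d" "0 \<le> L" using assms A_pos by (auto simp: d_def L_def)
  obtain C where "0 \<le> C" and C: "\<And>h z. h \<in> V \<Longrightarrow> ennreal (\<psi> \<mu> z * norm (Q \<mu> h z)) \<le> ennreal (C * N h * exp (- d * norm z powr A))
     + (\<integral>\<^sup>+t. ennreal (radial_kernel d R z t) * ennreal (L * (norm (h (t *\<^sub>R z)) * exp (- \<alpha> * norm (t *\<^sub>R z) powr A))) \<partial>lborel)"
    using \<psi>_Q_le[where R = R, OF assms(1,2) dg] \<open>1 \<le> R\<close> unfolding d_def L_def by fastforce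
  obtain J where "0 \<le> J" and J: "(\<integral>\<^sup>+(z::complex). ennreal (exp (- d * norm z powr A) powr p) \<partial>lborel) = ennreal J"
    using nn_integral_exp_powr_finite[OF \<open>0 < d\<close>, of 1]
    by (cases "(\<integral>\<^sup>+(z::complex). ennreal (exp (- d * norm z powr A) powr p) \<partial>lborel)") auto
  define D where "D = (1 / (d * A)) powr (p - 1) * kernel_const d"
  have "0 \<le> D" using \<open>0 < d\<close> A_pos by (simp add: D_def kernel_const_def)
  define K1 where "K1 = 2 powr p * (C powr p * J + D * L powr p)"
  have "0 \<le> K1" using \<open>0 \<le> J\<close> \<open>0 \<le> D\<close> by (simp add: K1_def)
  define K where "K = 2 powr p * (norm (1 / \<mu>) powr p + norm (1 / \<mu>\<^sup>2) powr p * K1)"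
  have WQ: "mass (\<lambda>z. W \<mu> z * Q \<mu> h z) \<le> ennreal (K1 * N h powr p)" if h: "h \<in> V" for h
  proof -
    note h_hol = holomorphic_fock[OF h]
    note [measurable] = borel_measurable_entire[OF h_hol]
    have [measurable]: "Q \<mu> h \<in> borel_measurable borel" "\<psi> \<mu> \<in> borel_measurable borel"
      by (rule borel_measurable_entire[OF Q_hol[OF h_hol]], rule borel_measurable_continuous_onI[OF continuous_on_\<psi>])
    define Y where "Y z = \<psi> \<mu> z * norm (Q \<mu> h z)" for z
    define P where "P z = C * N h * exp (- d * norm z powr A)" for z :: complex
    \<comment> \<open>The excess over the inner bound is dominated by the kernel integral
      alone.\<close>
    define x where "x z = max 0 (Y z - P z)" for z
    define u where "u z = L * (norm (h z) * exp (- \<alpha> * norm z powr A))" for z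
    have [measurable]: "Y \<in> borel_measurable borel" "P \<in> borel_measurable borel" "x \<in> borel_measurable borel" "u \<in> borel_measurable borel"
      unfolding Y_def P_def x_def u_def by measurable
    have nonneg: "0 \<le> Y z" "0 \<le> P z" "0 \<le> x z" "0 \<le> u z" for z
      using \<open>0 \<le> C\<close> \<open>0 \<le> L\<close> by (auto simp: Y_def P_def x_def u_def \<psi>_nonneg fock_norm_nonneg)
    have x_le: "ennreal (x z) \<le> (\<integral>\<^sup>+t. ennreal (radial_kernel d R z t) * ennreal (u (t *\<^sub>R z)) \<partial>lborel)" (is "_ \<le> ?X") for z
    proof (cases ?X)
      case (real x')
      have "ennreal (Y z) \<le> ennreal (P z) + ?X"
        unfolding Y_def P_def u_def by (rule C[OF h])
      then have "ennreal (Y z) \<le> ennreal (P z + x')"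
        using real nonneg by simp
      then have "Y z \<le> P z + x'"
        using real nonneg[of z] by (subst (asm) ennreal_le_iff) auto
      then show ?thesis
        using real nonneg[of z] by (simp add: x_def ennreal_le_iff)
    qed simp
    have "(\<integral>\<^sup>+z. ennreal (u z powr p) \<partial>lborel) = ennreal (L powr p) * mass h"
      unfolding mass_def u_def using \<open>0 \<le> L\<close>
      by (subst nn_integral_cmult[symmetric]) (auto simp: powr_mult ennreal_mult[symmetric])
    moreover have "(\<integral>\<^sup>+z. ennreal (x z powr p) \<partial>lborel) \<le> ennreal D * (\<integral>\<^sup>+z. ennreal (u z powr p) \<partial>lborel)"
      unfolding D_def by (rule radial_kernel_bounded[OF \<open>0 < d\<close> \<open>1 \<le> R\<close> _ _ _ x_le]) (use nonneg in auto)
    ultimately have x_int: "(\<integral>\<^sup>+z. ennreal (x z powr p) \<partial>lborel) \<le> ennreal (D * L powr p * N h powr p)"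
      using \<open>0 \<le> D\<close> by (simp add: mass_eq[OF h] ennreal_mult mult.assoc)
    have "(\<integral>\<^sup>+z. ennreal (P z powr p) \<partial>lborel) = (\<integral>\<^sup>+(z::complex). ennreal (C powr p * N h powr p) * ennreal (exp (- d * norm z powr A) powr p) \<partial>lborel)"
      using \<open>0 \<le> C\<close> by (simp add: P_def powr_mult fock_norm_nonneg ennreal_mult)
    also have "\<dots> = ennreal (C powr p * N h powr p) * ennreal J"
      unfolding J[symmetric] by (rule nn_integral_cmult) measurable
    also have "\<dots> = ennreal (C powr p * J * N h powr p)"
      using \<open>0 \<le> J\<close> by (simp add: ennreal_mult[symmetric] mult_ac)
    finally have P_int: "(\<integral>\<^sup>+z. ennreal (P z powr p) \<partial>lborel) = ennreal (C powr p * J * N h powr p)" .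
    have "mass (\<lambda>z. W \<mu> z * Q \<mu> h z) \<le> (\<integral>\<^sup>+z. ennreal ((P z + x z) powr p) \<partial>lborel)"
    proof (rule mass_mono_powr)
      fix z show "norm (W \<mu> z * Q \<mu> h z) * exp (- \<alpha> * norm z powr A) \<le> P z + x z"
        by (simp add: x_def Y_def \<psi>_def norm_mult mult_ac)
    qed
    also have "\<dots> \<le> ennreal (2 powr p) * ((\<integral>\<^sup>+z. ennreal (P z powr p) \<partial>lborel) + (\<integral>\<^sup>+z. ennreal (x z powr p) \<partial>lborel))"
      by (rule nn_integral_powr_add_le) (use nonneg in auto)
    also have "\<dots> \<le> ennreal (2 powr p) * (ennreal (C powr p * J * N h powr p) + ennreal (D * L powr p * N h powr p))"
      using x_int P_int by (intro mult_left_mono add_mono) auto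
    also have "\<dots> = ennreal (K1 * N h powr p)"
      using \<open>0 \<le> J\<close> \<open>0 \<le> D\<close>
      by (simp add: K1_def ennreal_plus[symmetric] ennreal_mult[symmetric] algebra_simps del: ennreal_plus)
    finally show ?thesis .
  qed
  have "mass (resolvent \<mu> h) \<le> ennreal K * mass h" if h: "h \<in> V" for h
  proof -
    note h_hol = holomorphic_fock[OF h]
    have WQ_hol: "(\<lambda>z. W \<mu> z * Q \<mu> h z) holomorphic_on UNIV"
      by (intro holomorphic_intros W_hol Q_hol h_hol)
    have "mass (resolvent \<mu> h) = mass (\<lambda>z. 1 / \<mu> * h z + 1 / \<mu>\<^sup>2 * (W \<mu> z * Q \<mu> h z))"
      by (simp add: resolvent_def[abs_def])
    also have "\<dots> \<le> ennreal (2 powr p) * (mass (\<lambda>z. 1 / \<mu> * h z) + mass (\<lambda>z. 1 / \<mu>\<^sup>2 * (W \<mu> z * Q \<mu> h z)))"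
      by (intro mass_add holomorphic_intros h_hol WQ_hol)
    also have "\<dots> = ennreal (2 powr p) * (ennreal (norm (1 / \<mu>) powr p) * mass h
        + ennreal (norm (1 / \<mu>\<^sup>2) powr p) * mass (\<lambda>z. W \<mu> z * Q \<mu> h z))"
      by (simp only: mass_cmult[OF h_hol] mass_cmult[OF WQ_hol])
    also have "\<dots> \<le> ennreal (2 powr p) * (ennreal (norm (1 / \<mu>) powr p) * mass h
        + ennreal (norm (1 / \<mu>\<^sup>2) powr p) * ennreal (K1 * N h powr p))"
      by (intro mult_left_mono add_mono WQ[OF h]) auto
    also have "\<dots> = ennreal K * mass h"
      unfolding mass_eq[OF h] using \<open>0 \<le> K1\<close>
      by (simp add: K_def ennreal_plus[symmetric] ennreal_mult[symmetric] algebra_simps del: ennreal_plus)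
    finally show ?thesis .
  qed
  moreover have "0 \<le> K" using \<open>0 \<le> K1\<close> by (simp add: K_def)
  ultimately show ?thesis by blast
qed

text \<open>At most one \<open>k\<close> satisfies \<open>A = real k\<close>; when \<open>A\<close> is not an integer the hypothesis is vacuous.\<close>

lemma deriv_g_growth:
  assumes "\<mu> \<noteq> 0" and small: "\<And>k. A = real k \<Longrightarrow> norm (c k) < \<alpha> * norm \<mu>"
  shows "\<exists>\<kappa> R. 0 \<le> \<kappa> \<and> \<kappa> < \<alpha> \<and> 1 \<le> R \<and>
    (\<forall>z. R \<le> norm z \<longrightarrow> norm (deriv g z) \<le> norm \<mu> * \<kappa> * A * norm z powr (A - 1))"
proof -
  \<comment> \<open>\<open>L r\<close> bounds \<open>deriv g\<close> on the circle of radius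
    \<open>r\<close>, relative to \<open>r powr (A - 1)\<close>. Its k-th term tends to
    \<open>l k\<close>: exponents below \<open>A\<close> die out, and only \<open>A = real k\<close>
    survives.\<close>
  define l where "l k = (if A = real k then norm (c k) * real k else 0)" for k
  define L where "L r = (\<Sum>k\<le>m. norm (c k) * real k * r powr (real k - A))" for r
  have lim: "(L \<longlongrightarrow> (\<Sum>k\<le>m. l k)) at_top"
    unfolding L_def
  proof (rule tendsto_sum)
    fix k assume "k \<in> {..m}"
    then have "real k \<le> A" using m_le by simp
    show "((\<lambda>r. norm (c k) * real k * r powr (real k - A)) \<longlongrightarrow> l k) at_top"
    proof (cases "A = real k")
      case True
      have "\<forall>\<^sub>F r in at_top. norm (c k) * real k * r powr (real k - A) = l k"
        using eventually_gt_at_top[of "0::real"] by eventually_elim (simp add: True l_def)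
      then show ?thesis by (rule tendsto_eventually)
    next
      case False
      then have "((\<lambda>r. r powr (real k - A)) \<longlongrightarrow> 0) at_top"
        using \<open>real k \<le> A\<close> by (intro tendsto_neg_powr filterlim_ident) auto
      then show ?thesis
        using False by (auto simp: l_def intro: tendsto_mult_right_zero)
    qed
  qed
  have "(\<Sum>k\<le>m. l k) = (\<Sum>k\<in>{m}. l k)"
    by (rule sum.mono_neutral_right) (auto simp: l_def m_def)
  also have "\<dots> < norm \<mu> * A * \<alpha>"
    using small[of m] A_pos \<alpha>_pos \<open>\<mu> \<noteq> 0\<close> by (auto simp: l_def mult_ac)
  finally have "(\<Sum>k\<le>m. l k) / (norm \<mu> * A) < \<alpha>"
    using A_pos \<open>\<mu> \<noteq> 0\<close> by (simp add: field_simps)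
  \<comment> \<open>The strict inequality leaves room for \<open>\<kappa>\<close> below
    \<open>\<alpha>\<close>, and this gap is the decay rate \<open>d\<close> used for the
    resolvent.\<close>
  then obtain \<kappa> where \<kappa>: "(\<Sum>k\<le>m. l k) / (norm \<mu> * A) < \<kappa>" "\<kappa> < \<alpha>"
    using dense by blast
  have "0 \<le> (\<Sum>k\<le>m. l k) / (norm \<mu> * A)"
    using A_pos by (intro divide_nonneg_nonneg sum_nonneg) (auto simp: l_def)
  then have "0 \<le> \<kappa>" using \<kappa> by linarith
  have "(\<Sum>k\<le>m. l k) < norm \<mu> * \<kappa> * A"
    using \<kappa>(1) A_pos \<open>\<mu> \<noteq> 0\<close> by (simp add: field_simps)
  then have "\<forall>\<^sub>F r in at_top. L r < norm \<mu> * \<kappa> * A"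
    by (rule order_tendstoD(2)[OF lim])
  then obtain R0 where R0: "\<And>r. R0 \<le> r \<Longrightarrow> L r < norm \<mu> * \<kappa> * A"
    by (auto simp: eventually_at_top_linorder)
  have "norm (deriv g z) \<le> norm \<mu> * \<kappa> * A * norm z powr (A - 1)" if z: "max 1 R0 \<le> norm z" for z
  proof -
    have "0 < norm z" using z by linarith
    have "norm (deriv g z) \<le> (\<Sum>k\<le>m. norm (c k * (of_nat k * z ^ (k - 1))))"
      unfolding deriv_g_eq by (rule norm_sum)
    also have "\<dots> = (\<Sum>k\<le>m. norm (c k) * real k * norm z powr (real k - A) * norm z powr (A - 1))"
    proof (rule sum.cong)
      fix k
      show "norm (c k * (of_nat k * z ^ (k - 1))) = norm (c k) * real k * norm z powr (real k - A) * norm z powr (A - 1)"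
      \<comment> \<open>The truncated \<open>k - 1\<close> at \<open>k = 0\<close> is harmless,
        since the factor \<open>k\<close> makes both sides 0.\<close>
      proof (cases k)
        case (Suc j)
        have "norm z powr (real k - A) * norm z powr (A - 1) = norm z ^ j"
          using \<open>0 < norm z\<close> by (simp add: powr_add[symmetric] powr_realpow Suc)
        then show ?thesis
          by (simp add: norm_mult norm_power Suc mult.assoc del: of_nat_Suc)
      qed simp
    qed simp
    also have "\<dots> = L (norm z) * norm z powr (A - 1)"
      by (simp add: L_def sum_distrib_right)
    also have "\<dots> \<le> norm \<mu> * \<kappa> * A * norm z powr (A - 1)"
      using R0[of "norm z"] z by (intro mult_right_mono) auto
    finally show ?thesis .
  qed
  then show ?thesis
    using \<open>0 \<le> \<kappa>\<close> \<kappa>(2) by (intro exI[of _ \<kappa>] exI[of _ "max 1 R0"]) auto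
qed

lemma not_in_spectrum:
  assumes "\<mu> \<noteq> 0" "\<And>k. A = real k \<Longrightarrow> norm (c k) < \<alpha> * norm \<mu>"
  shows "\<mu> \<notin> operator_spectrum V N T"
proof -
  obtain \<kappa> R where "0 \<le> \<kappa>" "\<kappa> < \<alpha>" "1 \<le> R"
    "\<And>z. R \<le> norm z \<Longrightarrow> norm (deriv g z) \<le> norm \<mu> * \<kappa> * A * norm z powr (A - 1)"
    using deriv_g_growth[OF assms] by blast
  from resolvent_mass_le[OF \<open>\<mu> \<noteq> 0\<close> this] obtain K
    where "0 \<le> K" "\<And>h. h \<in> V \<Longrightarrow> mass (resolvent \<mu> h) \<le> ennreal K * mass h" by blast
  then show ?thesis
    by (intro not_in_spectrum_if_resolvent_bounded[OF \<open>\<mu> \<noteq> 0\<close>])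
qed

end

theorem theorem1:
  fixes p \<alpha> A :: real and g :: "complex \<Rightarrow> complex"
  assumes "1 \<le> p" and "0 < \<alpha>" and "0 < A"
    and "g holomorphic_on UNIV"
    and "bounded_operator_on (fock_space p \<alpha> A) (fock_norm p \<alpha> A) (volterra g)"
  shows "(A \<notin> \<nat> \<longrightarrow>
            operator_spectrum (fock_space p \<alpha> A) (fock_norm p \<alpha> A) (volterra g) = {0}) \<and>
         (\<forall>n::nat. A = real n \<longrightarrow>
            operator_spectrum (fock_space p \<alpha> A) (fock_norm p \<alpha> A) (volterra g) =
              {\<mu>. norm \<mu> \<le> norm ((deriv ^^ n) g 0 / fact n) / \<alpha>})"
proof (intro conjI impI allI)
  interpret volterra_fock p \<alpha> A g
    using assms by unfold_locales
  show "operator_spectrum V N T = {0}" if "A \<notin> \<nat>"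
  proof -
    have "\<mu> = 0" if "\<mu> \<in> operator_spectrum V N T" for \<mu> :: complex
      using not_in_spectrum[of \<mu>] that \<open>A \<notin> \<nat>\<close> by (metis of_nat_in_Nats)
    then show ?thesis using zero_in_spectrum by blast
  qed
  show "operator_spectrum V N T = {\<mu>. norm \<mu> \<le> norm ((deriv ^^ n) g 0 / fact n) / \<alpha>}" if "A = real n" for n
  proof (intro equalityI subsetI)
    fix \<mu> :: complex assume \<mu>: "\<mu> \<in> operator_spectrum V N T"
    have "norm \<mu> * \<alpha> \<le> norm (c n)"
    proof (rule ccontr)
      assume "\<not> ?thesis"
      then have *: "norm (c n) < \<alpha> * norm \<mu>" by (simp add: mult.commute)
      then have "\<mu> \<noteq> 0" by auto
      moreover have "norm (c k) < \<alpha> * norm \<mu>" if "A = real k" for k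
        using * that \<open>A = real n\<close> by simp
      ultimately show False using not_in_spectrum \<mu> by blast
    qed
    then show "\<mu> \<in> {\<mu>. norm \<mu> \<le> norm ((deriv ^^ n) g 0 / fact n) / \<alpha>}"
      using \<alpha>_pos by (simp add: c_def pos_le_divide_eq)
  next
    fix \<mu> :: complex assume "\<mu> \<in> {\<mu>. norm \<mu> \<le> norm ((deriv ^^ n) g 0 / fact n) / \<alpha>}"
    \<comment> \<open>The centre is treated apart because \<open>W\<close> involves division by
      \<open>\<mu>\<close>.\<close>
    then show "\<mu> \<in> operator_spectrum V N T"
      using norm_le_spectral_bound_in_spectrum[OF \<open>A = real n\<close>, of \<mu>] zero_in_spectrum
      by (cases "\<mu> = 0") (auto simp: c_def)
  qed
qed

end
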